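(* Let $G$ be a finite supersolvable group and let $\chi,\psi\in\operatorname{Irr}(G)$. Let $\alpha\in\operatorname{Irr}(G)$ be any constituent of the product $\chi\psi$. Then $$\operatorname{dl}\big(\operatorname{Ker}(\alpha)/\operatorname{Ker}(\chi\psi)\big)\leq 2\,\eta(\chi\psi)-1.$$
   Context: All characters are complex characters of finite groups, and $\operatorname{Irr}(G)$ is the set of irreducible complex characters of $G$. For $\chi,\psi\in\operatorname{Irr}(G)$, the pointwise product $\chi\psi$ is a character of $G$, and $\eta(\chi\psi)$ denotes the number of distinct irreducible constituents of $\chi\psi$ (not counting multiplicity). $\operatorname{Ker}(\cdot)$ denotes the kernel of a character, and $\operatorname{dl}(H)$ denotes the derived length of a solvable group $H$. For every irreducible constituent $\alpha$ of $\chi\psi$ one has $\operatorname{Ker}(\chi\psi)\subseteq\operatorname{Ker}(\alpha)$. *)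

theory Defs
  imports
    Complex_Main
    "HOL-Algebra.Solvable_Groups"
    "HOL-Algebra.Elementary_Groups"
    "Jordan_Normal_Form.VS_Connect"
begin

definition supersolvable :: "('a, 'b) monoid_scheme \<Rightarrow> bool" where
  "supersolvable G \<longleftrightarrow> group G \<and>
     (\<exists>(N :: nat \<Rightarrow> 'a set) r.
        N 0 = {\<one>\<^bsub>G\<^esub>} \<and> N r = carrier G \<and>
        (\<forall>i\<le>r. N i \<lhd> G) \<and>
        (\<forall>i<r. N i \<subseteq> N (Suc i) \<and> cyclic_group (G\<lparr>carrier := N (Suc i)\<rparr> Mod N i)))"

text \<open>The value is meaningful only for solvable groups; otherwise the set of
  admissible \<open>n\<close> is empty and \<open>LEAST\<close> is unspecified.\<close>

definition derived_length :: "('a, 'b) monoid_scheme \<Rightarrow> nat" where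
  "derived_length G = (LEAST n. (derived G ^^ n) (carrier G) = {\<one>\<^bsub>G\<^esub>})"

text \<open>The unit group of the ring of \<open>n \<times> n\<close> matrices is \<open>GL(n, \<complex>)\<close>.\<close>

definition complex_rep :: "('a, 'b) monoid_scheme \<Rightarrow> nat \<Rightarrow> ('a \<Rightarrow> complex mat) \<Rightarrow> bool" where
  "complex_rep G n \<rho> \<longleftrightarrow> \<rho> \<in> hom G (units_of (ring_mat TYPE(complex) n ()))"

definition irreducible_rep :: "('a, 'b) monoid_scheme \<Rightarrow> nat \<Rightarrow> ('a \<Rightarrow> complex mat) \<Rightarrow> bool" where
  "irreducible_rep G n \<rho> \<longleftrightarrow> complex_rep G n \<rho> \<and> n > 0 \<and>
     (\<forall>W. VectorSpace.subspace class_ring W (module_vec TYPE(complex) n) \<and>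
          (\<forall>g\<in>carrier G. \<forall>v\<in>W. \<rho> g *\<^sub>v v \<in> W)
        \<longrightarrow> W = {0\<^sub>v n} \<or> W = carrier_vec n)"

text \<open>Characters are set to 0 outside the carrier, so that two characters are equal as
  HOL functions iff they agree on the group, and the pointwise product respects this
  convention.\<close>

definition character_of :: "('a, 'b) monoid_scheme \<Rightarrow> nat \<Rightarrow> ('a \<Rightarrow> complex mat) \<Rightarrow> 'a \<Rightarrow> complex" where
  "character_of G n \<rho> = (\<lambda>g. if g \<in> carrier G then \<Sum>i<n. \<rho> g $$ (i, i) else 0)"

definition Irr :: "('a, 'b) monoid_scheme \<Rightarrow> ('a \<Rightarrow> complex) set" where
  "Irr G = {\<chi>. \<exists>n \<rho>. irreducible_rep G n \<rho> \<and> \<chi> = character_of G n \<rho>}"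

definition char_prod :: "('a \<Rightarrow> complex) \<Rightarrow> ('a \<Rightarrow> complex) \<Rightarrow> 'a \<Rightarrow> complex" where
  "char_prod \<chi> \<psi> = (\<lambda>g. \<chi> g * \<psi> g)"

definition char_ker :: "('a, 'b) monoid_scheme \<Rightarrow> ('a \<Rightarrow> complex) \<Rightarrow> 'a set" where
  "char_ker G \<theta> = {g \<in> carrier G. \<theta> g = \<theta> \<one>\<^bsub>G\<^esub>}"

text \<open>The irreducible characters that occur with positive multiplicity \<open>m \<beta>\<close> in an expression
  of \<open>\<theta>\<close> as a sum of irreducible characters.\<close>

definition irr_constituents ::
    "('a, 'b) monoid_scheme \<Rightarrow> ('a \<Rightarrow> complex) \<Rightarrow> ('a \<Rightarrow> complex) set" where
  "irr_constituents G \<theta> =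
     {\<alpha>. \<exists>A (m :: ('a \<Rightarrow> complex) \<Rightarrow> nat).
        finite A \<and> A \<subseteq> Irr G \<and> \<alpha> \<in> A \<and> (\<forall>\<beta>\<in>A. m \<beta> > 0) \<and>
        (\<forall>g\<in>carrier G. \<theta> g = (\<Sum>\<beta>\<in>A. of_nat (m \<beta>) * \<beta> g))}"

definition eta :: "('a, 'b) monoid_scheme \<Rightarrow> ('a \<Rightarrow> complex) \<Rightarrow> nat" where
  "eta G \<theta> = card (irr_constituents G \<theta>)"

end

theory Submission
  imports
    Defs
    "HOL-Algebra.Multiplicative_Group"
    "Jordan_Normal_Form.Schur_Decomposition"
begin

text \<open>Let \<open>S\<close> be a nonempty set of constituents of \<open>\<chi>\<psi>\<close>, let \<open>N\<close> be the intersection of their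
  kernels and \<open>D = N''\<close>. If some constituent \<open>\<beta>\<close> has \<open>D \<subseteq> Ker \<beta>\<close> but not \<open>N \<subseteq> Ker \<beta>\<close>, then adding
  \<open>\<beta>\<close> to \<open>S\<close> costs two derived steps. Otherwise \<open>D\<close> and \<open>N\<close> have the same fixed points in the
  module \<open>V \<otimes> W\<close> affording \<open>\<chi>\<psi>\<close>, since a normal subgroup fixes all or nothing of an irreducible
  module; and there are nonzero ones because \<open>S\<close> is nonempty. Hence whatever commutes with \<open>D\<close> in
  its action on \<open>W\<close> maps \<open>N\<close>-fixed points to \<open>N\<close>-fixed points and so commutes with \<open>N\<close>. Climbing a
  chain of normal subgroups with cyclic factors, whose automorphisms commute, this shows that \<open>D\<close>
  and \<open>N\<close> commute on \<open>W\<close>, and then that \<open>N\<close> acts on \<open>W\<close> as an abelian group. The same holds on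
  \<open>V\<close>, so \<open>N' \<subseteq> Ker \<chi>\<psi>\<close>. Starting from \<open>S = {\<alpha>}\<close>, at most \<open>2 (\<eta> - 1) + 1\<close> derived steps are used.\<close>

section \<open>Supersolvable groups\<close>

context group
begin

lemma conj_int_pow:
  assumes "g \<in> carrier G" "c \<in> carrier G"
  shows "g \<otimes> c [^] (k::int) \<otimes> inv g = (g \<otimes> c \<otimes> inv g) [^] k"
proof -
  have "(\<lambda>x. g \<otimes> x \<otimes> inv g) \<in> hom G G"
  proof (rule homI)
    fix x y assume "x \<in> carrier G" "y \<in> carrier G"
    then show "g \<otimes> (x \<otimes> y) \<otimes> inv g = g \<otimes> x \<otimes> inv g \<otimes> (g \<otimes> y \<otimes> inv g)"
      using assms by (simp add: m_assoc inv_solve_left inv_solve_left')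
  qed (use assms in simp)
  from hom_int_pow[OF this] show ?thesis
    using assms is_group by blast
qed

lemma commute_subgroup:
  assumes "y \<in> carrier G"
  shows "subgroup {g \<in> carrier G. g \<otimes> y = y \<otimes> g} G"
proof (rule subgroupI)
  fix a assume "a \<in> {g \<in> carrier G. g \<otimes> y = y \<otimes> g}"
  then have a: "a \<in> carrier G" "a \<otimes> y = y \<otimes> a" by auto
  have "inv a \<otimes> y = inv a \<otimes> (y \<otimes> a) \<otimes> inv a" using a(1) assms by (simp add: m_assoc)
  also have "\<dots> = y \<otimes> inv a" using a(1) assms a(2)[symmetric] by (simp add: m_assoc[symmetric])
  finally show "inv a \<in> {g \<in> carrier G. g \<otimes> y = y \<otimes> g}" using a by auto
next
  fix a b assume "a \<in> {g \<in> carrier G. g \<otimes> y = y \<otimes> g}" "b \<in> {g \<in> carrier G. g \<otimes> y = y \<otimes> g}"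
  then have a: "a \<in> carrier G" "a \<otimes> y = y \<otimes> a" and b: "b \<in> carrier G" "b \<otimes> y = y \<otimes> b" by auto
  have "a \<otimes> b \<otimes> y = a \<otimes> y \<otimes> b" using a(1) b assms by (simp add: m_assoc)
  also have "\<dots> = y \<otimes> (a \<otimes> b)" using a b assms by (simp add: m_assoc)
  finally show "a \<otimes> b \<in> {g \<in> carrier G. g \<otimes> y = y \<otimes> g}" using a b by auto
qed (use assms in \<open>auto simp: exI[of _ \<one>]\<close>)

text \<open>A derived subgroup is generated by commutators and the centralizer of \<open>y\<close>
  is a subgroup, so it is enough to test the commutators.\<close>

lemma commute_derived:
  assumes "H \<subseteq> carrier G" "y \<in> carrier G"
    and "\<And>a b. a \<in> H \<Longrightarrow> b \<in> H \<Longrightarrow> a \<otimes> b \<otimes> inv a \<otimes> inv b \<otimes> y = y \<otimes> (a \<otimes> b \<otimes> inv a \<otimes> inv b)"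
    and "x \<in> derived G H"
  shows "x \<otimes> y = y \<otimes> x"
proof -
  have "derived G H \<subseteq> {g \<in> carrier G. g \<otimes> y = y \<otimes> g}"
    unfolding derived_def
    by (rule generate_subgroup_incl[OF _ commute_subgroup]) (use assms in auto)
  then show ?thesis using assms(4) by auto
qed

text \<open>The automorphisms of a cyclic group commute, being power maps.\<close>

lemma derived_centralizes_cyclic_normal:
  assumes c: "c \<in> carrier G"
    and conj: "\<And>g. g \<in> carrier G \<Longrightarrow> \<exists>k::int. g \<otimes> c \<otimes> inv g = c [^] k"
    and x: "x \<in> derived G (carrier G)"
  shows "x \<otimes> c [^] (j::int) = c [^] j \<otimes> x"
proof (rule commute_derived[OF _ _ _ x])
  fix a b assume a: "a \<in> carrier G" and b: "b \<in> carrier G"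
  obtain k l k' l' :: int where
    k: "a \<otimes> c \<otimes> inv a = c [^] k" and l: "b \<otimes> c \<otimes> inv b = c [^] l" and
    k': "inv a \<otimes> c \<otimes> inv (inv a) = c [^] k'" and l': "inv b \<otimes> c \<otimes> inv (inv b) = c [^] l'"
    using conj[OF a] conj[OF b] conj[of "inv a"] conj[of "inv b"] a b by auto
  have K: "a \<otimes> c [^] i \<otimes> inv a = c [^] (k * i)" for i :: int
    using conj_int_pow[OF a c, of i] k c by (simp add: int_pow_pow)
  have L: "b \<otimes> c [^] i \<otimes> inv b = c [^] (l * i)" for i :: int
    using conj_int_pow[OF b c, of i] l c by (simp add: int_pow_pow)
  have K': "inv a \<otimes> c [^] i \<otimes> a = c [^] (k' * i)" for i :: int
    using conj_int_pow[of "inv a" c i] a k' c by (simp add: int_pow_pow)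
  have L': "inv b \<otimes> c [^] i \<otimes> b = c [^] (l' * i)" for i :: int
    using conj_int_pow[of "inv b" c i] b l' c by (simp add: int_pow_pow)
  \<comment> \<open>The order of \<open>c\<close> may be finite, so \<open>k * k'\<close> need not
    be 1. It acts as 1 on exponents of \<open>c\<close> because the two conjugations undo each
    other.\<close>
  have kk: "c [^] (k * (k' * i)) = c [^] i" for i :: int
    unfolding K[symmetric] K'[symmetric] using a c by (simp add: m_assoc inv_solve_left) (simp add: m_assoc[symmetric])
  have ll: "c [^] (l * (l' * i)) = c [^] i" for i :: int
    unfolding L[symmetric] L'[symmetric] using b c by (simp add: m_assoc inv_solve_left) (simp add: m_assoc[symmetric])
  let ?u = "a \<otimes> b \<otimes> inv a \<otimes> inv b"
  \<comment> \<open>Conjugation by the commutator is four nested conjugations, each multiplying the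
    exponent by an integer. Integers commute, which brings \<open>k\<close> next to
    \<open>k'\<close> and \<open>l\<close> next to \<open>l'\<close>.\<close>
  have "?u \<otimes> c [^] j \<otimes> inv ?u = a \<otimes> (b \<otimes> (inv a \<otimes> (inv b \<otimes> c [^] j \<otimes> b) \<otimes> a) \<otimes> inv b) \<otimes> inv a"
    using a b c by (simp add: m_assoc inv_mult_group)
  also have "\<dots> = c [^] (k * (k' * (l * (l' * j))))"
    unfolding L' K' L K by (simp add: algebra_simps)
  also have "\<dots> = c [^] j" by (simp add: kk ll)
  finally have e: "?u \<otimes> c [^] j \<otimes> inv ?u = c [^] j" .
  have u: "?u \<in> carrier G" using a b by simp
  have "?u \<otimes> c [^] j = ?u \<otimes> c [^] j \<otimes> inv ?u \<otimes> ?u"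
    using inv_solve_right[OF _ _ u] u c by (metis inv_closed inv_inv int_pow_closed m_closed)
  then show "?u \<otimes> c [^] j = c [^] j \<otimes> ?u" unfolding e .
qed (use c in auto)

text \<open>In the quotient by \<open>N\<close> the image of \<open>M\<close> is a cyclic normal
  subgroup, which the derived subgroup of the quotient centralizes. Commuting modulo
  \<open>N\<close> puts the commutator into \<open>N\<close>.\<close>

lemma derived_centralizes_cyclic_factor:
  assumes N: "N \<lhd> G" and M: "M \<lhd> G" and NM: "N \<subseteq> M"
    and cyc: "cyclic_group (G\<lparr>carrier := M\<rparr> Mod N)"
    and x: "x \<in> derived G (carrier G)" and y: "y \<in> M"
  shows "y \<otimes> x \<otimes> inv y \<otimes> inv x \<in> N"
proof -
  interpret N: normal N G by fact
  interpret M: normal M G by fact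
  let ?Q = "G Mod N" and ?p = "\<lambda>a. N #> a"
  interpret Q: group ?Q by (rule N.factorgroup_is_group)
  interpret p: group_hom G ?Q ?p
    by unfold_locales (rule N.r_coset_hom_Mod)
  have NM': "N \<lhd> G\<lparr>carrier := M\<rparr>"
    using normal_restrict_supergroup[OF M.subgroup_axioms N NM] .
  interpret NM: normal N "G\<lparr>carrier := M\<rparr>" by fact
  interpret R: group "G\<lparr>carrier := M\<rparr> Mod N" by (rule NM.factorgroup_is_group)
  obtain C where C: "C \<in> carrier (G\<lparr>carrier := M\<rparr> Mod N)"
    and gen: "carrier (G\<lparr>carrier := M\<rparr> Mod N) = range (\<lambda>k::int. C [^]\<^bsub>G\<lparr>carrier := M\<rparr> Mod N\<^esub> k)"
    using cyc R.cyclic_group by blast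
  obtain c where c: "c \<in> M" "C = N #> c"
    using C by (auto simp: carrier_FactGroup r_coset_def)
  have cG: "c \<in> carrier G" using c by auto
  \<comment> \<open>\<open>cyc\<close> speaks of powers in the quotient of \<open>M\<close>, while
    the argument runs in the quotient of \<open>G\<close>; both powers are the coset of the same
    power of \<open>c\<close>.\<close>
  have pw: "C [^]\<^bsub>G\<lparr>carrier := M\<rparr> Mod N\<^esub> k = ?p c [^]\<^bsub>?Q\<^esub> k" for k :: int
  proof -
    have "C [^]\<^bsub>G\<lparr>carrier := M\<rparr> Mod N\<^esub> k = N #> (c [^]\<^bsub>G\<lparr>carrier := M\<rparr>\<^esub> k)"
      using NM.FactGroup_int_pow[of c k] c by (simp add: r_coset_def)
    also have "c [^]\<^bsub>G\<lparr>carrier := M\<rparr>\<^esub> k = c [^] k"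
      using int_pow_consistent[OF M.subgroup_axioms c(1)] by simp
    finally show ?thesis using p.hom_int_pow[OF cG] by simp
  qed
  have pM: "\<exists>k::int. ?p z = ?p c [^]\<^bsub>?Q\<^esub> k" if "z \<in> M" for z
  proof -
    have "?p z \<in> carrier (G\<lparr>carrier := M\<rparr> Mod N)"
      using that by (auto simp: carrier_FactGroup r_coset_def)
    then show ?thesis unfolding gen pw by auto
  qed
  obtain k :: int where k: "?p y = ?p c [^]\<^bsub>?Q\<^esub> k" using pM[OF y] by auto
  have "?p x \<in> derived ?Q (carrier ?Q)"
    using p.derived_img[OF order_refl] x by (metis carrier_FactGroup imageI)
  then have "?p x \<otimes>\<^bsub>?Q\<^esub> ?p y = ?p y \<otimes>\<^bsub>?Q\<^esub> ?p x"
    unfolding k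
  proof (rule Q.derived_centralizes_cyclic_normal[rotated 2])
    fix g assume "g \<in> carrier ?Q"
    then obtain h where h: "h \<in> carrier G" "g = ?p h" by (auto simp: carrier_FactGroup)
    have "g \<otimes>\<^bsub>?Q\<^esub> ?p c \<otimes>\<^bsub>?Q\<^esub> inv\<^bsub>?Q\<^esub> g = ?p (h \<otimes> c \<otimes> inv h)"
      using h cG by (simp del: mult_FactGroup)
    then show "\<exists>k::int. g \<otimes>\<^bsub>?Q\<^esub> ?p c \<otimes>\<^bsub>?Q\<^esub> inv\<^bsub>?Q\<^esub> g = ?p c [^]\<^bsub>?Q\<^esub> k"
      using pM[OF M.inv_op_closed2[OF h(1) c(1)]] by simp
  qed (use cG in auto)
  then have comm: "?p (y \<otimes> x) = ?p (x \<otimes> y)"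
    using y x derived_in_carrier[OF order_refl] by (metis M.subset p.hom_mult subsetD)
  have xy: "x \<in> carrier G" "y \<in> carrier G" using x y derived_in_carrier[OF order_refl] by auto
  \<comment> \<open>The commutator is \<open>y \<otimes> x\<close> times the inverse of
    \<open>x \<otimes> y\<close>, and these two products have the same coset.\<close>
  have "?p (y \<otimes> x \<otimes> inv y \<otimes> inv x) = ?p (y \<otimes> x) \<otimes>\<^bsub>?Q\<^esub> inv\<^bsub>?Q\<^esub> (?p (x \<otimes> y))"
    using xy p.hom_mult[of "y \<otimes> x" "inv (x \<otimes> y)"] p.hom_inv[of "x \<otimes> y"]
    by (simp del: mult_FactGroup p.hom_mult p.hom_inv add: inv_mult_group m_assoc)
  also have "\<dots> = N" unfolding comm using xy by (simp del: mult_FactGroup)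
  finally show ?thesis
    using rcos_self[of "y \<otimes> x \<otimes> inv y \<otimes> inv x" N] N.subgroup_axioms xy by simp
qed

end

section \<open>Commutators and central factors\<close>

context group
begin

lemma inv_cancel:
  assumes "x \<in> carrier G" "y \<in> carrier G"
  shows "inv x \<otimes> (x \<otimes> y) = y" "x \<otimes> (inv x \<otimes> y) = y"
  using assms by (simp_all add: m_assoc[symmetric])

text \<open>Conjugation by \<open>y\<close> multiplies \<open>a\<close> by \<open>z\<close> and
  \<open>b\<close> by \<open>w\<close>. These factors commute with \<open>a\<close>, with
  \<open>b\<close> and with each other, so they cancel in the commutator of \<open>a\<close> and
  \<open>b\<close>.\<close>

lemma commutator_commutes_if_twisted_centrally:
  assumes car: "y \<in> carrier G" "a \<in> carrier G" "b \<in> carrier G" "z \<in> carrier G" "w \<in> carrier G"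
    and ya: "y \<otimes> a = z \<otimes> a \<otimes> y" and yb: "y \<otimes> b = w \<otimes> b \<otimes> y"
    and za: "z \<otimes> a = a \<otimes> z" and zb: "z \<otimes> b = b \<otimes> z"
    and wa: "w \<otimes> a = a \<otimes> w" and wb: "w \<otimes> b = b \<otimes> w" and zw: "z \<otimes> w = w \<otimes> z"
  shows "a \<otimes> b \<otimes> inv a \<otimes> inv b \<otimes> y = y \<otimes> (a \<otimes> b \<otimes> inv a \<otimes> inv b)"
proof -
  let ?u = "a \<otimes> b \<otimes> inv a \<otimes> inv b" and ?v = "z \<otimes> w"
  have v: "?v \<in> carrier G" using car by simp
  note C = commute_subgroup[OF v]
  have av: "a \<otimes> ?v = ?v \<otimes> a"
    using car by (simp add: m_assoc[symmetric] za[symmetric]) (simp add: m_assoc wa)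
  have bv: "b \<otimes> ?v = ?v \<otimes> b"
    using car by (simp add: m_assoc[symmetric] zb[symmetric]) (simp add: m_assoc wb)
  have uv: "?u \<otimes> ?v = ?v \<otimes> ?u"
  proof -
    have ab: "a \<in> {g \<in> carrier G. g \<otimes> ?v = ?v \<otimes> g}" "b \<in> {g \<in> carrier G. g \<otimes> ?v = ?v \<otimes> g}"
      using av bv car by auto
    have "?u \<in> {g \<in> carrier G. g \<otimes> ?v = ?v \<otimes> g}"
      by (intro subgroup.m_closed[OF C] subgroup.m_inv_closed[OF C] ab)
    then show ?thesis by blast
  qed
  have u: "?u \<in> carrier G" using car by simp
  \<comment> \<open>The commutator is the factor by which \<open>a \<otimes> b\<close> differs from
    \<open>b \<otimes> a\<close>, and conjugation by \<open>y\<close> multiplies both of these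
    products by the same \<open>?v\<close>.\<close>
  have uba: "?u \<otimes> (b \<otimes> a) = a \<otimes> b"
    using car by (simp add: m_assoc inv_cancel)
  have "y \<otimes> (a \<otimes> b) = z \<otimes> a \<otimes> (y \<otimes> b)" using car ya by (simp add: m_assoc[symmetric])
  also have "\<dots> = ?v \<otimes> (a \<otimes> b) \<otimes> y"
  proof -
    have "z \<otimes> a \<otimes> (w \<otimes> b \<otimes> y) = z \<otimes> (a \<otimes> w) \<otimes> b \<otimes> y" using car by (simp add: m_assoc)
    then show ?thesis unfolding yb wa[symmetric] using car by (simp add: m_assoc)
  qed
  finally have 1: "y \<otimes> (a \<otimes> b) = ?v \<otimes> (a \<otimes> b) \<otimes> y" .
  have "y \<otimes> (b \<otimes> a) = w \<otimes> b \<otimes> (y \<otimes> a)" using car yb by (simp add: m_assoc[symmetric])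
  also have "\<dots> = w \<otimes> z \<otimes> (b \<otimes> a) \<otimes> y"
  proof -
    have "w \<otimes> b \<otimes> (z \<otimes> a \<otimes> y) = w \<otimes> (b \<otimes> z) \<otimes> a \<otimes> y" using car by (simp add: m_assoc)
    then show ?thesis unfolding ya zb[symmetric] using car by (simp add: m_assoc)
  qed
  finally have 2: "y \<otimes> (b \<otimes> a) = ?v \<otimes> (b \<otimes> a) \<otimes> y" unfolding zw .
  have "?u \<otimes> y \<otimes> (b \<otimes> a) = ?u \<otimes> ?v \<otimes> (b \<otimes> a) \<otimes> y"
    using 2 car u v by (simp add: m_assoc)
  also have "\<dots> = ?v \<otimes> (?u \<otimes> (b \<otimes> a)) \<otimes> y" unfolding uv using car u v by (simp add: m_assoc)
  also have "\<dots> = y \<otimes> (?u \<otimes> (b \<otimes> a))" unfolding uba 1 ..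
  also have "\<dots> = y \<otimes> ?u \<otimes> (b \<otimes> a)" using car u by (simp add: m_assoc)
  finally show ?thesis using car u right_cancel[of "b \<otimes> a" "?u \<otimes> y" "y \<otimes> ?u"] by blast
qed

end

text \<open>Climbing the cyclic series, \<open>h ` (M i \<inter> N'')\<close> centralizes \<open>h ` N\<close>: a commutator of an
  element of the next term with an element of \<open>N'\<close> falls into \<open>M i\<close>, so that the next term
  centralizes \<open>h ` N''\<close>. Hence \<open>h ` N\<close> centralizes \<open>h ` N''\<close>, and then also itself.\<close>

lemma (in group_hom) derived_in_kernel_if_supersolvable:
  assumes ss: "supersolvable G" and N: "N \<lhd> G"
    and step: "\<And>y. y \<in> carrier G \<Longrightarrow>
        (\<And>d. d \<in> derived G (derived G N) \<Longrightarrow> h y \<otimes>\<^bsub>H\<^esub> h d = h d \<otimes>\<^bsub>H\<^esub> h y) \<Longrightarrow>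
        (\<And>x. x \<in> N \<Longrightarrow> h y \<otimes>\<^bsub>H\<^esub> h x = h x \<otimes>\<^bsub>H\<^esub> h y)"
    and x: "x \<in> derived G N"
  shows "h x = \<one>\<^bsub>H\<^esub>"
proof -
  interpret N: normal N G by fact
  let ?D = "derived G (derived G N)"
  interpret N': normal "derived G N" G by (rule G.derived_is_normal[OF N])
  interpret D: normal "?D" G by (rule G.derived_is_normal[OF N'.normal_axioms])
  have N'N: "derived G N \<subseteq> N" by (rule G.derived_incl[OF order_refl N.subgroup_axioms])
  have DN': "?D \<subseteq> derived G N" by (rule G.derived_incl[OF order_refl N'.subgroup_axioms])
  obtain M r where M0: "M 0 = {\<one>\<^bsub>G\<^esub>}" and Mr: "M r = carrier G"
    and Mn: "\<And>i. i \<le> r \<Longrightarrow> M i \<lhd> G"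
    and MM: "\<And>i. i < r \<Longrightarrow> M i \<subseteq> M (Suc i) \<and> cyclic_group (G\<lparr>carrier := M (Suc i)\<rparr> Mod M i)"
    using ss unfolding supersolvable_def by blast
  have central: "i \<le> r \<Longrightarrow> y \<in> M i \<inter> ?D \<Longrightarrow> x \<in> N \<Longrightarrow> h y \<otimes>\<^bsub>H\<^esub> h x = h x \<otimes>\<^bsub>H\<^esub> h y" for i y x
  proof (induction i arbitrary: y x)
    case 0
    then show ?case using M0 by auto
  next
    case (Suc i)
    then have y: "y \<in> M (Suc i)" "y \<in> ?D" and i: "i < r" by auto
    interpret Mi: normal "M i" G using Mn[of i] i by simp
    have yG: "y \<in> carrier G" using y by auto
    \<comment> \<open>\<open>derived G N\<close> lies in the derived subgroup of \<open>G\<close>,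
      which centralizes the cyclic factor, so the commutator drops into \<open>M i\<close>.
      Normality of \<open>?D\<close> keeps it in \<open>?D\<close>.\<close>
    have c: "y \<otimes> a \<otimes> inv y \<otimes> inv a \<in> M i \<inter> ?D" if a: "a \<in> derived G N" for a
    proof
      show "y \<otimes> a \<otimes> inv y \<otimes> inv a \<in> M i"
        using G.derived_centralizes_cyclic_factor[of "M i" "M (Suc i)" a y] Mn MM[OF i] i y(1)
          a G.mono_derived[OF N.subset] by auto
      have "y \<otimes> (a \<otimes> inv y \<otimes> inv a) \<in> ?D"
        using y(2) a by (intro D.m_closed D.inv_op_closed2) auto
      then show "y \<otimes> a \<otimes> inv y \<otimes> inv a \<in> ?D" using yG a by (simp add: G.m_assoc)
    qed
    show ?case
    \<comment> \<open>By \<open>step\<close> only the image of \<open>?D\<close> has to be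
      centralized, and that is generated by commutators of images of elements of
      \<open>derived G N\<close>.\<close>
    proof (rule step[OF yG _ Suc.prems(3)])
      fix d assume "d \<in> ?D"
      then have "h d \<in> derived H (h ` derived G N)"
        using derived_img[OF N'.subset] by auto
      then have "h d \<otimes>\<^bsub>H\<^esub> h y = h y \<otimes>\<^bsub>H\<^esub> h d"
      proof (rule H.commute_derived[rotated -1])
        fix a' b' assume "a' \<in> h ` derived G N" "b' \<in> h ` derived G N"
        then obtain a b where a: "a \<in> derived G N" "a' = h a" and b: "b \<in> derived G N" "b' = h b"
          by auto
        let ?z = "y \<otimes> a \<otimes> inv y \<otimes> inv a" and ?w = "y \<otimes> b \<otimes> inv y \<otimes> inv b"
        have aN: "a \<in> N" "b \<in> N" using a b N'N by auto
        have wN: "?w \<in> N" using c[OF b(1)] DN' N'N by auto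
        have zG: "?z \<in> carrier G" "?w \<in> carrier G" using yG a b by auto
        note IH = Suc.IH[OF less_imp_le[OF i] c]
        \<comment> \<open>The commutator of \<open>y\<close> and \<open>e\<close> is the factor that
          conjugation by \<open>y\<close> puts before \<open>e\<close>. By the induction hypothesis
          its image commutes with the image of \<open>N\<close>.\<close>
        have t: "y \<otimes> e = y \<otimes> e \<otimes> inv y \<otimes> inv e \<otimes> e \<otimes> y" if "e \<in> derived G N" for e
          using that yG by (simp add: G.m_assoc G.inv_cancel)
        have tw: "h y \<otimes>\<^bsub>H\<^esub> h e = h z \<otimes>\<^bsub>H\<^esub> h e \<otimes>\<^bsub>H\<^esub> h y"
          if "e \<in> carrier G" "z \<in> carrier G" "y \<otimes> e = z \<otimes> e \<otimes> y" for e z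
          using that yG by (simp flip: hom_mult)
        show "a' \<otimes>\<^bsub>H\<^esub> b' \<otimes>\<^bsub>H\<^esub> inv\<^bsub>H\<^esub> a' \<otimes>\<^bsub>H\<^esub> inv\<^bsub>H\<^esub> b' \<otimes>\<^bsub>H\<^esub> h y
            = h y \<otimes>\<^bsub>H\<^esub> (a' \<otimes>\<^bsub>H\<^esub> b' \<otimes>\<^bsub>H\<^esub> inv\<^bsub>H\<^esub> a' \<otimes>\<^bsub>H\<^esub> inv\<^bsub>H\<^esub> b')"
          unfolding a b
        proof (rule H.commutator_commutes_if_twisted_centrally[of _ _ _ "h ?z" "h ?w"])
          show "h y \<otimes>\<^bsub>H\<^esub> h a = h ?z \<otimes>\<^bsub>H\<^esub> h a \<otimes>\<^bsub>H\<^esub> h y"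
            by (rule tw[OF _ _ t]) (use zG a in auto)
          show "h y \<otimes>\<^bsub>H\<^esub> h b = h ?w \<otimes>\<^bsub>H\<^esub> h b \<otimes>\<^bsub>H\<^esub> h y"
            by (rule tw[OF _ _ t]) (use zG b in auto)
          show "h ?z \<otimes>\<^bsub>H\<^esub> h a = h a \<otimes>\<^bsub>H\<^esub> h ?z" "h ?z \<otimes>\<^bsub>H\<^esub> h b = h b \<otimes>\<^bsub>H\<^esub> h ?z"
            "h ?z \<otimes>\<^bsub>H\<^esub> h ?w = h ?w \<otimes>\<^bsub>H\<^esub> h ?z"
            by (rule IH[OF a(1)]; fact)+
          show "h ?w \<otimes>\<^bsub>H\<^esub> h a = h a \<otimes>\<^bsub>H\<^esub> h ?w" "h ?w \<otimes>\<^bsub>H\<^esub> h b = h b \<otimes>\<^bsub>H\<^esub> h ?w"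
            by (rule IH[OF b(1)]; fact)+
        qed (rule hom_closed; use yG zG a b in simp)+
      qed (use yG in auto)
      then show "h y \<otimes>\<^bsub>H\<^esub> h d = h d \<otimes>\<^bsub>H\<^esub> h y" ..
    qed
  qed
  have DN: "h d \<otimes>\<^bsub>H\<^esub> h x = h x \<otimes>\<^bsub>H\<^esub> h d" if "d \<in> ?D" "x \<in> N" for d x
    using central[of r d x] that Mr by auto
  \<comment> \<open>\<open>step\<close> a second time, now for elements of \<open>N\<close>, whose
    images commute with the image of \<open>?D\<close> by \<open>DN\<close>.\<close>
  have NN: "h y \<otimes>\<^bsub>H\<^esub> h x = h x \<otimes>\<^bsub>H\<^esub> h y" if "y \<in> N" "x \<in> N" for x y
    using step[of y x] DN that by (metis N.mem_carrier)
  have "derived G N \<subseteq> kernel G H h"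
    unfolding derived_def
  proof (rule G.generate_subgroup_incl[OF _ subgroup_kernel], clarsimp)
    fix a b assume ab: "a \<in> N" "b \<in> N"
    have "h (a \<otimes> b \<otimes> inv a \<otimes> inv b) = h a \<otimes>\<^bsub>H\<^esub> h b \<otimes>\<^bsub>H\<^esub> inv\<^bsub>H\<^esub> (h b \<otimes>\<^bsub>H\<^esub> h a)"
      using ab by (simp add: H.inv_mult_group H.m_assoc)
    also have "\<dots> = \<one>\<^bsub>H\<^esub>" unfolding NN[OF ab] using ab by simp
    finally show "a \<otimes> b \<otimes> inv a \<otimes> inv b \<in> kernel G H h"
      using ab by (simp add: kernel_def)
  qed
  then show ?thesis using x by (auto simp: kernel_def)
qed

section \<open>Idempotent matrices and matrices of finite order\<close>

definition mtrace :: "'a::comm_ring_1 mat \<Rightarrow> 'a" where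
  "mtrace A = (\<Sum>i<dim_row A. A $$ (i, i))"

lemma mtrace_mult_commute:
  assumes "A \<in> carrier_mat n m" "B \<in> carrier_mat m n"
  shows "mtrace (A * B) = mtrace (B * A)"
proof -
  have "mtrace (A * B) = (\<Sum>i<n. \<Sum>j<m. A $$ (i,j) * B $$ (j,i))"
    using assms by (auto simp: mtrace_def scalar_prod_def lessThan_atLeast0 intro!: sum.cong)
  also have "\<dots> = (\<Sum>j<m. \<Sum>i<n. B $$ (j,i) * A $$ (i,j))"
    by (subst sum.swap) (simp add: mult.commute)
  also have "\<dots> = mtrace (B * A)"
    using assms by (auto simp: mtrace_def scalar_prod_def lessThan_atLeast0 intro!: sum.cong)
  finally show ?thesis .
qed

text \<open>Schur decomposition, since a complex characteristic polynomial splits. Similarity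
  preserves the trace and is compatible with powers, which is what the later arguments
  compare.\<close>

lemma complex_mat_triangularizable:
  fixes A :: "complex mat"
  assumes A: "A \<in> carrier_mat n n"
  obtains B P Q where "B \<in> carrier_mat n n" "P \<in> carrier_mat n n" "Q \<in> carrier_mat n n"
    "upper_triangular B" "P * Q = 1\<^sub>m n" "Q * P = 1\<^sub>m n" "A = P * B * Q" "mtrace A = mtrace B"
    "\<And>k. A ^\<^sub>m k = P * B ^\<^sub>m k * Q"
proof -
  obtain as where "char_poly A = (\<Prod>a\<leftarrow>as. [:- a, 1:])"
    using char_poly_factorized[OF A] by blast
  from schur_decomposition_exists[OF A this] obtain B where B: "B \<in> carrier_mat n n"
    "upper_triangular B" "similar_mat A B" by blast
  then obtain P Q where w: "similar_mat_wit A B P Q" unfolding similar_mat_def by blast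
  note d = similar_mat_witD2[OF A w]
  have "mtrace A = mtrace (P * (B * Q))" using d by (simp add: assoc_mult_mat)
  also have "\<dots> = mtrace (B * Q * P)" using d by (intro mtrace_mult_commute) auto
  also have "\<dots> = mtrace (B * (Q * P))" using d by (simp add: assoc_mult_mat)
  also have "\<dots> = mtrace B" using d by simp
  finally have t: "mtrace A = mtrace B" .
  show ?thesis
    by (rule that[of B P Q]) (use d B t similar_mat_wit_pow_id[OF w] in auto)
qed

lemma mat_mult_index_sum:
  assumes "A \<in> carrier_mat n m" "B \<in> carrier_mat m l" "i < n" "j < l"
  shows "(A * B) $$ (i,j) = (\<Sum>k<m. A $$ (i,k) * B $$ (k,j))"
  using assms by (auto simp: scalar_prod_def lessThan_atLeast0 intro!: sum.cong)

text \<open>Outside the interval one of the two factors lies below the diagonal. The shortened sum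
  is what makes induction on \<open>j - i\<close> work.\<close>

lemma upper_triangular_mult_index:
  assumes A: "A \<in> carrier_mat n n" "upper_triangular A"
    and B: "B \<in> carrier_mat n n" "upper_triangular B"
    and ij: "i < n" "j < n"
  shows "(A * B) $$ (i,j) = (\<Sum>k\<in>{i..j}. A $$ (i,k) * B $$ (k,j))"
proof -
  have z: "A $$ (i,k) * B $$ (k,j) = 0" if "k < n" "k \<notin> {i..j}" for k
    using that upper_triangularD[OF A(2), of k i] upper_triangularD[OF B(2), of j k] A(1) B(1) ij
    by (cases "k < i") auto
  have "(\<Sum>k<n. A $$ (i,k) * B $$ (k,j)) = (\<Sum>k\<in>{i..j}. A $$ (i,k) * B $$ (k,j))"
    using ij z by (intro sum.mono_neutral_right) auto
  then show ?thesis using mat_mult_index_sum[OF A(1) B(1) ij] by simp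
qed

lemma upper_triangular_mult:
  assumes "A \<in> carrier_mat n n" "upper_triangular A" "B \<in> carrier_mat n n" "upper_triangular B"
  shows "upper_triangular (A * B)"
  using upper_triangular_mult_index[OF assms] assms by (intro upper_triangularI) auto

lemma upper_triangular_pow:
  fixes B :: "'a::comm_ring_1 mat"
  assumes B: "B \<in> carrier_mat n n" "upper_triangular B"
  shows "upper_triangular (B ^\<^sub>m k)" and "i < n \<Longrightarrow> (B ^\<^sub>m k) $$ (i,i) = (B $$ (i,i)) ^ k"
proof -
  have "upper_triangular (B ^\<^sub>m k) \<and> (\<forall>i<n. (B ^\<^sub>m k) $$ (i,i) = (B $$ (i,i)) ^ k)"
  proof (induction k)
    case 0
    then show ?case using B by (auto intro!: upper_triangularI)
  next
    case (Suc k)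
    have c: "B ^\<^sub>m k \<in> carrier_mat n n" using B by (simp add: pow_carrier_mat)
    show ?case
      using upper_triangular_mult[OF c _ B] upper_triangular_mult_index[OF c _ B] Suc
      by (auto simp: mult.commute)
  qed
  then show "upper_triangular (B ^\<^sub>m k)" and "i < n \<Longrightarrow> (B ^\<^sub>m k) $$ (i,i) = (B $$ (i,i)) ^ k"
    by auto
qed

text \<open>The trace of an idempotent is its rank. Concretely, a triangular idempotent has diagonal
  entries 0 or 1, which are all 0 if they sum to 0, and a strictly triangular idempotent
  vanishes.\<close>

lemma idempotent_mat_trace_zero:
  fixes E :: "complex mat"
  assumes E: "E \<in> carrier_mat n n" and idem: "E * E = E" and tr: "mtrace E = 0"
  shows "E = 0\<^sub>m n n"
proof -
  obtain B P Q where c: "B \<in> carrier_mat n n" "P \<in> carrier_mat n n" "Q \<in> carrier_mat n n"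
    and ut: "upper_triangular B" and PQ: "P * Q = 1\<^sub>m n" "Q * P = 1\<^sub>m n" and EB: "E = P * B * Q"
    and trB: "mtrace E = mtrace B"
    by (rule complex_mat_triangularizable[OF E])
  have BE: "B = Q * E * P"
  proof -
    have "Q * E * P = (Q * P) * B * (Q * P)" unfolding EB using c by (simp add: assoc_mult_mat[of _ n n _ n _ n])
    then show ?thesis unfolding PQ using c by simp
  qed
  have "B * B = Q * E * (P * Q) * E * P"
    unfolding BE using c E by (simp add: assoc_mult_mat[of _ n n _ n _ n])
  also have "\<dots> = Q * (E * E) * P" unfolding PQ using c E by (simp add: assoc_mult_mat[of _ n n _ n _ n])
  also have "\<dots> = B" unfolding idem BE ..
  finally have BB: "B * B = B" .
  have rec: "B $$ (i,j) = (\<Sum>k\<in>{i..j}. B $$ (i,k) * B $$ (k,j))" if "i < n" "j < n" for i j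
    using upper_triangular_mult_index[OF c(1) ut c(1) ut that] BB by simp
  have d01: "B $$ (i,i) \<in> {0, 1}" if "i < n" for i
    using rec[OF that that] by auto
  then have nonneg: "Re (B $$ (i,i)) \<ge> 0" if "i < n" for i using that by force
  have "(\<Sum>i<n. Re (B $$ (i,i))) = 0"
    using tr c trB by (simp add: mtrace_def flip: Re_sum)
  then have "Re (B $$ (i,i)) = 0" if "i < n" for i
    using that nonneg by (subst (asm) sum_nonneg_eq_0_iff) auto
  then have d0: "B $$ (i,i) = 0" if "i < n" for i using d01[OF that] that by force
  \<comment> \<open>Each summand in \<open>rec\<close> has a factor that is on the diagonal or
    nearer to it. Subtraction is truncated, so entries below the diagonal are covered too, with an
    empty sum.\<close>
  have "B $$ (i,j) = 0" if "i < n" "j < n" for i j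
    using that
  proof (induction "j - i" arbitrary: i j rule: less_induct)
    case less
    have "B $$ (i,k) * B $$ (k,j) = 0" if "k \<in> {i..j}" for k
    proof (cases "k = i \<or> k = j")
      case False
      then have "k < j" "i \<le> k" "j < n" "i \<noteq> k" using that less.prems by auto
      then show ?thesis using less.hyps[of k i] by simp
    qed (use d0 less.prems in auto)
    then have "(\<Sum>k\<in>{i..j}. B $$ (i,k) * B $$ (k,j)) = 0" by (intro sum.neutral) blast
    then show ?case using rec[OF less.prems] by simp
  qed
  then have "B = 0\<^sub>m n n" using c by (intro eq_matI) auto
  then show ?thesis using EB c by simp
qed

text \<open>Induction on the distance from the diagonal: once all nearer off-diagonal entries
  vanish, an entry of the power \<open>t\<close> is \<open>t\<close> times that of \<open>B\<close>.
  At \<open>t = k\<close> it is 0, and in characteristic 0 one may divide by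
  \<open>k\<close>.\<close>

lemma unipotent_finite_order:
  fixes B :: "'a::field_char_0 mat"
  assumes B: "B \<in> carrier_mat n n" "upper_triangular B" and k: "B ^\<^sub>m k = 1\<^sub>m n" "k > 0"
    and d: "\<And>i. i < n \<Longrightarrow> B $$ (i,i) = 1"
  shows "B = 1\<^sub>m n"
proof -
  have c: "B ^\<^sub>m t \<in> carrier_mat n n" for t using B by (simp add: pow_carrier_mat)
  have "B $$ (i,j) = 0" if "i < j" "j < n" for i j
    using that
  proof (induction "j - i" arbitrary: i j rule: less_induct)
    case less
    have IH: "B $$ (a,b) = 0" if "i \<le> a" "a < b" "b \<le> j" "b - a < j - i" for a b
      using less.hyps[of b a] that less.prems by auto
    have diag: "(B ^\<^sub>m t) $$ (l,l) = 1" if "l < n" for t l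
      using upper_triangular_pow(2)[OF B that] d[OF that] by simp
    have step: "(B ^\<^sub>m Suc t) $$ (i,l) = (\<Sum>k\<in>{i..l}. (B ^\<^sub>m t) $$ (i,k) * B $$ (k,l))"
      if "l \<le> j" for t l
      using upper_triangular_mult_index[OF c upper_triangular_pow(1)[OF B] B, of i l] less.prems that
      by simp
    \<comment> \<open>In the sum for position \<open>(i,j)\<close> of the next power only the two
      end terms then survive.\<close>
    have near: "(B ^\<^sub>m t) $$ (i,l) = 0" if "i < l" "l < j" for t l
      using that
    proof (induction t arbitrary: l)
      case 0
      then show ?case using B less.prems by simp
    next
      case (Suc t)
      have "(B ^\<^sub>m t) $$ (i,k) * B $$ (k,l) = 0" if "k \<in> {i..l}" for k
        using that Suc.IH[of k] IH[of i l] Suc.prems by (cases "k = i"; cases "k = l") auto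
      then show ?case using step[of l t] Suc.prems by (simp del: pow_mat.simps add: sum.neutral)
    qed
    have "(B ^\<^sub>m t) $$ (i,j) = of_nat t * B $$ (i,j)" for t
    proof (induction t)
      case 0
      then show ?case using B less.prems by simp
    next
      case (Suc t)
      have "(\<Sum>k\<in>{i..j}. (B ^\<^sub>m t) $$ (i,k) * B $$ (k,j))
          = (\<Sum>k\<in>{i,j}. (B ^\<^sub>m t) $$ (i,k) * B $$ (k,j))"
        using less.prems near by (intro sum.mono_neutral_right) auto
      then show ?case
        using step[of j t] less.prems Suc d[of j] diag[of i] by (simp add: algebra_simps)
    qed
    from this[of k] show ?case using k less.prems by simp
  qed
  moreover have "B $$ (i,j) = 0" if "j < i" "i < n" for i j
    using upper_triangularD[OF B(2) that(1)] that B by simp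
  ultimately have "B $$ (i,j) = 0" if "i \<noteq> j" "i < n" "j < n" for i j
    using that by (metis linorder_neqE_nat)
  then show ?thesis using B d by (intro eq_matI) auto
qed

text \<open>The eigenvalues are roots of unity. A sum of \<open>n\<close> numbers of modulus 1
  equals \<open>n\<close> only if all of them are 1, and then the triangular form is unipotent of
  finite order.\<close>

lemma finite_order_mat_trace:
  fixes A :: "complex mat"
  assumes A: "A \<in> carrier_mat n n" and k: "A ^\<^sub>m k = 1\<^sub>m n" "k > 0"
  shows "cmod (mtrace A) \<le> n" and "mtrace A = of_nat n \<Longrightarrow> A = 1\<^sub>m n"
proof -
  obtain B P Q where c: "B \<in> carrier_mat n n" "P \<in> carrier_mat n n" "Q \<in> carrier_mat n n"
    and ut: "upper_triangular B" and PQ: "P * Q = 1\<^sub>m n" "Q * P = 1\<^sub>m n" and AB: "A = P * B * Q"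
    and trB: "mtrace A = mtrace B" and pow: "A ^\<^sub>m k = P * B ^\<^sub>m k * Q"
    using complex_mat_triangularizable[OF A] by metis
  have cp: "B ^\<^sub>m k \<in> carrier_mat n n" using c by (simp add: pow_carrier_mat)
  have conj: "C = Q * (P * C * Q) * P" if "C \<in> carrier_mat n n" for C
  proof -
    have "Q * (P * C * Q) * P = (Q * P) * C * (Q * P)"
      using c that by (simp add: assoc_mult_mat[of _ n n _ n _ n])
    then show ?thesis unfolding PQ left_mult_one_mat[OF that] right_mult_one_mat[OF that] ..
  qed
  have "B ^\<^sub>m k = Q * (A ^\<^sub>m k) * P"
    unfolding pow by (rule conj[OF cp])
  also have "\<dots> = 1\<^sub>m n" unfolding k using c PQ by simp
  finally have Bk: "B ^\<^sub>m k = 1\<^sub>m n" .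
  have pw: "(B $$ (i,i)) ^ k = 1" if "i < n" for i
    using upper_triangular_pow(2)[OF c(1) ut that, of k] Bk that by simp
  have norm1: "cmod (B $$ (i,i)) = 1" if "i < n" for i
  proof (rule power_eq_imp_eq_base[of _ k])
    show "cmod (B $$ (i,i)) ^ k = 1 ^ k" using pw[OF that]
      by (metis norm_one norm_power power_one)
  qed (use k in auto)
  have tr: "mtrace B = (\<Sum>i<n. B $$ (i,i))" using c by (simp add: mtrace_def)
  have "cmod (mtrace B) \<le> (\<Sum>i<n. cmod (B $$ (i,i)))" unfolding tr by (rule norm_sum)
  also have "\<dots> = n" using norm1 by simp
  finally show "cmod (mtrace A) \<le> n" unfolding trB .
  assume "mtrace A = of_nat n"
  then have "(\<Sum>i<n. 1 - Re (B $$ (i,i))) = 0"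
    unfolding trB tr by (simp add: sum_subtractf flip: Re_sum)
  moreover have "1 - Re (B $$ (i,i)) \<ge> 0" if "i < n" for i
    using norm1[OF that] complex_Re_le_cmod[of "B $$ (i,i)"] by simp
  ultimately have re: "Re (B $$ (i,i)) = 1" if "i < n" for i
    using that by (subst (asm) sum_nonneg_eq_0_iff) auto
  have "B $$ (i,i) = 1" if "i < n" for i
    using re[OF that] norm1[OF that] by (simp add: complex_eq_iff cmod_def)
  then have "B = 1\<^sub>m n" using unipotent_finite_order[OF c(1) ut Bk k(2)] by blast
  then show "A = 1\<^sub>m n" unfolding AB using c PQ by simp
qed

text \<open>Transfer from matrices to any finite index set by enumerating it; tensor products will
  be indexed by pairs.\<close>

lemma idempotent_kernel_trace_zero:
  fixes p :: "'i \<Rightarrow> 'i \<Rightarrow> complex"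
  assumes fin: "finite I"
    and idem: "\<And>i j. i \<in> I \<Longrightarrow> j \<in> I \<Longrightarrow> (\<Sum>k\<in>I. p i k * p k j) = p i j"
    and tr: "(\<Sum>i\<in>I. p i i) = 0" and ij: "i \<in> I" "j \<in> I"
  shows "p i j = 0"
proof -
  let ?n = "card I"
  obtain h where h: "bij_betw h {..<?n} I"
    using ex_bij_betw_nat_finite[OF fin] by (auto simp: lessThan_atLeast0)
  let ?E = "mat ?n ?n (\<lambda>(a,b). p (h a) (h b))"
  have hI: "h a \<in> I" if "a < ?n" for a using h that by (auto dest: bij_betwE)
  have E: "?E \<in> carrier_mat ?n ?n" by simp
  have "?E * ?E = ?E"
  proof (rule eq_matI)
    fix a b assume "a < dim_row ?E" "b < dim_col ?E"
    then have ab: "a < ?n" "b < ?n" by auto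
    have "(?E * ?E) $$ (a,b) = (\<Sum>k<?n. p (h a) (h k) * p (h k) (h b))"
      using mat_mult_index_sum[OF E E ab] ab by simp
    also have "\<dots> = (\<Sum>k\<in>I. p (h a) k * p k (h b))"
      by (rule sum.reindex_bij_betw[OF h])
    finally show "(?E * ?E) $$ (a,b) = ?E $$ (a,b)" using idem hI ab by simp
  qed auto
  moreover have "mtrace ?E = (\<Sum>i\<in>I. p i i)"
    using sum.reindex_bij_betw[OF h, of "\<lambda>i. p i i"] by (simp add: mtrace_def)
  ultimately have Z: "?E = 0\<^sub>m ?n ?n" using idempotent_mat_trace_zero[OF E] tr by simp
  obtain a b where "a < ?n" "b < ?n" "i = h a" "j = h b"
    using ij h unfolding bij_betw_def by (metis imageE lessThan_iff)
  then show ?thesis using arg_cong[OF Z, of "\<lambda>M. M $$ (a,b)"] by simp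
qed

section \<open>Averages and fixed vectors\<close>

text \<open>A matrix representation with rows and columns indexed by an arbitrary finite set \<open>I\<close>, so
  that the action on rectangular matrices, with \<open>I\<close> a set of pairs, is an instance.\<close>

locale index_rep = group G for G (structure) +
  fixes I :: "'i set" and r :: "'a \<Rightarrow> 'i \<Rightarrow> 'i \<Rightarrow> complex"
  assumes finite_carrier: "finite (carrier G)" and finite_I: "finite I"
    and r_mult: "\<And>g h i j. g \<in> carrier G \<Longrightarrow> h \<in> carrier G \<Longrightarrow> i \<in> I \<Longrightarrow> j \<in> I \<Longrightarrow>
        r (g \<otimes> h) i j = (\<Sum>k\<in>I. r g i k * r h k j)"
begin

text \<open>For a subgroup \<open>K\<close>, the projection onto the vectors fixed by
  \<open>K\<close>.\<close>

definition avg :: "'a set \<Rightarrow> 'i \<Rightarrow> 'i \<Rightarrow> complex" where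
  "avg K i j = (\<Sum>g\<in>K. r g i j) / card K"

definition fixed :: "'a set \<Rightarrow> ('i \<Rightarrow> complex) \<Rightarrow> bool" where
  "fixed K x \<longleftrightarrow> (\<forall>g\<in>K. \<forall>i\<in>I. (\<Sum>j\<in>I. r g i j * x j) = x i)"

lemma subgroup_finite_nonempty: "subgroup K G \<Longrightarrow> finite K \<and> K \<noteq> {}"
  using finite_subset[OF subgroup.subset finite_carrier] subgroup.one_closed[of K G]
  by auto

text \<open>Multiplication by \<open>g\<close> permutes \<open>K\<close>, so the average absorbs
  \<open>r g\<close> on either side.\<close>

lemma r_avg:
  assumes K: "subgroup K G" and g: "g \<in> K" and ij: "i \<in> I" "j \<in> I"
  shows "(\<Sum>k\<in>I. r g i k * avg K k j) = avg K i j" and "(\<Sum>k\<in>I. avg K i k * r g k j) = avg K i j"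
proof -
  interpret K: subgroup K G by fact
  have bl: "bij_betw (\<lambda>h. g \<otimes> h) K K"
    by (rule bij_betw_byWitness[where f' = "\<lambda>h. inv g \<otimes> h"]) (use g in \<open>auto simp: inv_cancel\<close>)
  have br: "bij_betw (\<lambda>h. h \<otimes> g) K K"
    by (rule bij_betw_byWitness[where f' = "\<lambda>h. h \<otimes> inv g"]) (use g in \<open>auto simp: m_assoc\<close>)
  have "(\<Sum>k\<in>I. r g i k * avg K k j) = (\<Sum>h\<in>K. \<Sum>k\<in>I. r g i k * r h k j) / card K"
    unfolding avg_def by (subst sum.swap) (simp add: sum_distrib_left sum_divide_distrib)
  also have "\<dots> = (\<Sum>h\<in>K. r (g \<otimes> h) i j) / card K"
    using g ij by (simp add: r_mult)
  also have "\<dots> = avg K i j" unfolding avg_def sum.reindex_bij_betw[OF bl, of "\<lambda>h. r h i j"] ..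
  finally show "(\<Sum>k\<in>I. r g i k * avg K k j) = avg K i j" .
  have "(\<Sum>k\<in>I. avg K i k * r g k j) = (\<Sum>h\<in>K. \<Sum>k\<in>I. r h i k * r g k j) / card K"
    unfolding avg_def by (subst sum.swap) (simp add: sum_distrib_right sum_divide_distrib)
  also have "\<dots> = (\<Sum>h\<in>K. r (h \<otimes> g) i j) / card K"
    using g ij by (simp add: r_mult)
  also have "\<dots> = avg K i j" unfolding avg_def sum.reindex_bij_betw[OF br, of "\<lambda>h. r h i j"] ..
  finally show "(\<Sum>k\<in>I. avg K i k * r g k j) = avg K i j" .
qed

text \<open>Absorption of single elements, averaged over \<open>D\<close>. The case
  \<open>D = K\<close> is idempotence; for smaller \<open>D\<close> it places one projection below
  the other.\<close>

lemma avg_avg: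
  assumes K: "subgroup K G" and D: "subgroup D G" "D \<subseteq> K" and ij: "i \<in> I" "j \<in> I"
  shows "(\<Sum>k\<in>I. avg D i k * avg K k j) = avg K i j" and "(\<Sum>k\<in>I. avg K i k * avg D k j) = avg K i j"
proof -
  have D0: "of_nat (card D) \<noteq> (0::complex)" using subgroup_finite_nonempty[OF D(1)] by simp
  have "(\<Sum>k\<in>I. avg D i k * avg K k j) = (\<Sum>g\<in>D. \<Sum>k\<in>I. r g i k * avg K k j) / card D"
    unfolding avg_def[of D] by (subst sum.swap) (simp add: sum_distrib_right sum_divide_distrib)
  also have "\<dots> = (\<Sum>g\<in>D. avg K i j) / card D"
    using r_avg(1)[OF K _ ij] D(2) by (simp add: subset_iff)
  finally show "(\<Sum>k\<in>I. avg D i k * avg K k j) = avg K i j" using D0 by simp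
  have "(\<Sum>k\<in>I. avg K i k * avg D k j) = (\<Sum>g\<in>D. \<Sum>k\<in>I. avg K i k * r g k j) / card D"
    unfolding avg_def[of D] by (subst sum.swap) (simp add: sum_distrib_left sum_divide_distrib)
  also have "\<dots> = (\<Sum>g\<in>D. avg K i j) / card D"
    using r_avg(2)[OF K _ ij] D(2) by (simp add: subset_iff)
  finally show "(\<Sum>k\<in>I. avg K i k * avg D k j) = avg K i j" using D0 by simp
qed

lemma fixed_imp_avg_fixed:
  assumes K: "subgroup K G" and x: "fixed K x" and i: "i \<in> I"
  shows "(\<Sum>j\<in>I. avg K i j * x j) = x i"
proof -
  have "(\<Sum>j\<in>I. avg K i j * x j) = (\<Sum>g\<in>K. \<Sum>j\<in>I. r g i j * x j) / card K"
    unfolding avg_def by (subst sum.swap) (simp add: sum_distrib_right sum_divide_distrib)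
  also have "\<dots> = (\<Sum>g\<in>K. x i) / card K" using x i by (simp add: fixed_def)
  finally show ?thesis using subgroup_finite_nonempty[OF K] by simp
qed

text \<open>A nonzero trace leaves a nonzero diagonal entry, and the column of the projection
  through it is a fixed vector.\<close>

lemma fixed_nonzero_exists:
  assumes K: "subgroup K G" and tr: "(\<Sum>i\<in>I. avg K i i) \<noteq> 0"
  shows "\<exists>x. fixed K x \<and> (\<exists>i\<in>I. x i \<noteq> 0)"
proof -
  obtain j where j: "j \<in> I" "avg K j j \<noteq> 0" using tr by (metis (mono_tags, lifting) sum.neutral)
  have "fixed K (\<lambda>i. avg K i j)" using r_avg(1)[OF K] j by (auto simp: fixed_def)
  then show ?thesis using j by blast
qed

lemma fixed_zero_if_trace_zero:
  assumes K: "subgroup K G" and tr: "(\<Sum>i\<in>I. avg K i i) = 0" and x: "fixed K x" and i: "i \<in> I"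
  shows "x i = 0"
proof -
  have "avg K a b = 0" if "a \<in> I" "b \<in> I" for a b
  proof (rule idempotent_kernel_trace_zero[where p = "avg K" and I = I])
    show "finite I" by (rule finite_I)
    show "(\<Sum>i\<in>I. avg K i i) = 0" by (rule tr)
    show "(\<Sum>k\<in>I. avg K i k * avg K k j) = avg K i j" if "i \<in> I" "j \<in> I" for i j
      by (rule avg_avg(1)[OF K K order_refl that])
  qed (rule that)+
  then have "(\<Sum>j\<in>I. avg K i j * x j) = 0" using i by (intro sum.neutral) auto
  then show ?thesis unfolding fixed_imp_avg_fixed[OF K x i] .
qed

text \<open>The average over \<open>K\<close> absorbs the one over \<open>D\<close> on both sides,
  so their difference is idempotent. Its trace is 0, hence the two projections coincide.\<close>

lemma fixed_if_trace_eq: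
  assumes K: "subgroup K G" and D: "subgroup D G" "D \<subseteq> K"
    and tr: "(\<Sum>i\<in>I. avg D i i) = (\<Sum>i\<in>I. avg K i i)" and x: "fixed D x"
  shows "fixed K x"
proof -
  let ?p = "\<lambda>i j. avg D i j - avg K i j"
  have "?p i j = 0" if ij: "i \<in> I" "j \<in> I" for i j
  proof (rule idempotent_kernel_trace_zero[where p = ?p and I = I])
    show "finite I" "i \<in> I" "j \<in> I" by (fact finite_I ij)+
    show "(\<Sum>i\<in>I. ?p i i) = 0" using tr by (simp add: sum_subtractf)
    fix i j assume "i \<in> I" "j \<in> I"
    then show "(\<Sum>k\<in>I. ?p i k * ?p k j) = ?p i j"
      using avg_avg(1)[OF K K order_refl, of i j] avg_avg(1)[OF D(1) D(1) order_refl, of i j]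
        avg_avg[OF K D, of i j]
      by (simp add: left_diff_distrib right_diff_distrib sum_subtractf)
  qed
  then have pe: "avg K i j = avg D i j" if "i \<in> I" "j \<in> I" for i j using that by simp
  have xK: "x i = (\<Sum>j\<in>I. avg K i j * x j)" if "i \<in> I" for i
    unfolding fixed_imp_avg_fixed[OF D(1) x that, symmetric]
    by (rule sum.cong) (simp_all add: pe that)
  show ?thesis unfolding fixed_def
  proof (intro ballI)
    fix g i assume g: "g \<in> K" and i: "i \<in> I"
    have "(\<Sum>j\<in>I. r g i j * x j) = (\<Sum>j\<in>I. r g i j * (\<Sum>k\<in>I. avg K j k * x k))"
      by (intro sum.cong refl arg_cong2[where f = "(*)"] xK)
    also have "\<dots> = (\<Sum>k\<in>I. (\<Sum>j\<in>I. r g i j * avg K j k) * x k)"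
      by (simp add: sum_distrib_left sum_distrib_right mult.assoc) (rule sum.swap)
    also have "\<dots> = (\<Sum>k\<in>I. avg K i k * x k)" using r_avg(1)[OF K g i] by simp
    finally show "(\<Sum>j\<in>I. r g i j * x j) = x i" by (simp only: xK[OF i, symmetric])
  qed
qed

lemma trace_avg: "(\<Sum>i\<in>I. avg K i i) = (\<Sum>g\<in>K. \<Sum>i\<in>I. r g i i) / card K"
  unfolding avg_def by (subst sum.swap) (simp add: sum_divide_distrib)

end

section \<open>Complex representations\<close>

abbreviation GL :: "nat \<Rightarrow> complex mat monoid" where
  "GL n \<equiv> units_of (ring_mat TYPE(complex) n ())"

lemma GL_group: "group (GL n)"
  using ring_mat[of n "()"] ring.is_monoid monoid.units_group by blast

lemma GL_simps:
  "monoid.mult (GL n) = (*)" "one (GL n) = 1\<^sub>m n" "carrier (GL n) \<subseteq> carrier_mat n n"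
  by (auto simp: units_of_def Units_def ring_mat_simps)

context group
begin

lemma complex_rep_group_hom:
  assumes "complex_rep G n \<rho>" shows "group_hom G (GL n) \<rho>"
  using assms GL_group is_group unfolding complex_rep_def group_hom_def group_hom_axioms_def by auto

lemma complex_rep_carrier:
  assumes "complex_rep G n \<rho>" "g \<in> carrier G" shows "\<rho> g \<in> carrier_mat n n"
  using group_hom.hom_closed[OF complex_rep_group_hom] assms GL_simps(3) by blast

lemma complex_rep_mult:
  assumes "complex_rep G n \<rho>" "g \<in> carrier G" "h \<in> carrier G" shows "\<rho> (g \<otimes> h) = \<rho> g * \<rho> h"
  using group_hom.hom_mult[OF complex_rep_group_hom[OF assms(1)] assms(2,3)] by (simp add: GL_simps)

lemma complex_rep_one:
  assumes "complex_rep G n \<rho>" shows "\<rho> \<one> = 1\<^sub>m n"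
  using group_hom.hom_one[OF complex_rep_group_hom[OF assms]] by (simp add: GL_simps)

lemma complex_rep_inv:
  assumes "complex_rep G n \<rho>" "g \<in> carrier G"
  shows "\<rho> (inv g) * \<rho> g = 1\<^sub>m n" "\<rho> g * \<rho> (inv g) = 1\<^sub>m n"
  using complex_rep_mult[OF assms(1), of "inv g" g] complex_rep_mult[OF assms(1), of g "inv g"]
    complex_rep_one[OF assms(1)] assms(2) by auto

lemma complex_repI:
  assumes "\<And>g. g \<in> carrier G \<Longrightarrow> \<rho> g \<in> carrier_mat n n" "\<rho> \<one> = 1\<^sub>m n"
    and "\<And>g h. g \<in> carrier G \<Longrightarrow> h \<in> carrier G \<Longrightarrow> \<rho> (g \<otimes> h) = \<rho> g * \<rho> h"
  shows "complex_rep G n \<rho>"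
  unfolding complex_rep_def
proof (rule homI)
  fix g assume g: "g \<in> carrier G"
  have "\<rho> (inv g) * \<rho> g = 1\<^sub>m n" "\<rho> g * \<rho> (inv g) = 1\<^sub>m n"
    using assms(3)[of "inv g" g] assms(3)[of g "inv g"] assms(2) g by auto
  then show "\<rho> g \<in> carrier (GL n)"
    using assms(1)[OF g] assms(1)[of "inv g"] g
    by (auto simp: units_of_def Units_def ring_mat_simps)
qed (simp add: GL_simps assms)

text \<open>The dual representation. Through it intertwiners of two representations become matrices
  fixed by the group.\<close>

lemma contragredient:
  assumes "complex_rep G n \<rho>"
  shows "complex_rep G n (\<lambda>g. (\<rho> (inv g))\<^sup>T)"
proof (rule complex_repI)
  show "(\<rho> (inv g))\<^sup>T \<in> carrier_mat n n" if "g \<in> carrier G" for g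
    using complex_rep_carrier[OF assms, of "inv g"] that by simp
  show "(\<rho> (inv \<one>))\<^sup>T = 1\<^sub>m n" using complex_rep_one[OF assms] by simp
  fix g h assume "g \<in> carrier G" "h \<in> carrier G"
  then show "(\<rho> (inv (g \<otimes> h)))\<^sup>T = (\<rho> (inv g))\<^sup>T * (\<rho> (inv h))\<^sup>T"
    using complex_rep_carrier[OF assms] complex_rep_mult[OF assms]
    by (simp add: inv_mult_group transpose_mult[of _ n n _ n])
qed

lemma complex_rep_pow:
  assumes "complex_rep G n \<rho>" "g \<in> carrier G" shows "\<rho> (g [^] (k::nat)) = \<rho> g ^\<^sub>m k"
  using assms complex_rep_carrier[OF assms]
  by (induction k) (auto simp: complex_rep_one complex_rep_mult)

lemma character_of_eq_mtrace:
  assumes "complex_rep G n \<rho>" "g \<in> carrier G" shows "character_of G n \<rho> g = mtrace (\<rho> g)"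
  using complex_rep_carrier[OF assms] assms(2) by (simp add: character_of_def mtrace_def)

lemma character_of_one:
  assumes "complex_rep G n \<rho>" shows "character_of G n \<rho> \<one> = of_nat n"
  using complex_rep_one[OF assms] by (simp add: character_of_def)

lemma complex_rep_finite_order:
  assumes "complex_rep G n \<rho>" "g \<in> carrier G" "finite (carrier G)"
  shows "\<rho> g ^\<^sub>m Coset.order G = 1\<^sub>m n" "Coset.order G > 0"
  using complex_rep_pow[OF assms(1,2), of "Coset.order G"] pow_order_eq_1[OF assms(2)] assms
  by (auto simp: complex_rep_one order_gt_0_iff_finite)

lemma norm_character_of_le:
  assumes "complex_rep G n \<rho>" "g \<in> carrier G" "finite (carrier G)"
  shows "cmod (character_of G n \<rho> g) \<le> n"
  using finite_order_mat_trace(1)[OF complex_rep_carrier[OF assms(1,2)] complex_rep_finite_order[OF assms]]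
  by (simp add: character_of_eq_mtrace[OF assms(1,2)])

text \<open>A matrix of finite order whose trace is its size is the identity, so the character alone
  detects the kernel of the representation.\<close>

lemma char_ker_character_of:
  assumes "complex_rep G n \<rho>" "finite (carrier G)"
  shows "char_ker G (character_of G n \<rho>) = kernel G (GL n) \<rho>"
proof -
  have "character_of G n \<rho> g = of_nat n \<longleftrightarrow> \<rho> g = 1\<^sub>m n" if g: "g \<in> carrier G" for g
    using finite_order_mat_trace(2)[OF complex_rep_carrier[OF assms(1) g]
        complex_rep_finite_order[OF assms(1) g assms(2)]] character_of_eq_mtrace[OF assms(1) g]
    by (auto simp: mtrace_def)
  then show ?thesis
    unfolding char_ker_def kernel_def by (auto simp: character_of_one[OF assms(1)] GL_simps)
qed

lemma irreducible_rep_subspace: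
  assumes irr: "irreducible_rep G n \<rho>"
    and W: "W \<subseteq> carrier_vec n" "0\<^sub>v n \<in> W" "\<And>v w. v \<in> W \<Longrightarrow> w \<in> W \<Longrightarrow> v + w \<in> W"
      "\<And>c v. v \<in> W \<Longrightarrow> c \<cdot>\<^sub>v v \<in> W"
    and inv: "\<And>g v. g \<in> carrier G \<Longrightarrow> v \<in> W \<Longrightarrow> \<rho> g *\<^sub>v v \<in> W"
  shows "W = {0\<^sub>v n} \<or> W = carrier_vec n"
proof -
  interpret V: vec_space "TYPE(complex)" n .
  have "VectorSpace.subspace class_ring W (module_vec TYPE(complex) n)"
    unfolding VectorSpace.subspace_def submodule_def
    using V.vectorspace_axioms V.module_axioms W by (auto simp: module_vec_simps)
  then show ?thesis using irr inv unfolding irreducible_rep_def by blast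
qed

end

lemma index_rep_vec:
  assumes "group G" "complex_rep G n \<rho>" "finite (carrier G)"
  shows "index_rep G {..<n} (\<lambda>g i j. \<rho> g $$ (i,j))"
proof -
  interpret group G by fact
  show ?thesis
    using assms(3) mat_mult_index_sum[OF complex_rep_carrier[OF assms(2)] complex_rep_carrier[OF assms(2)]]
    by unfold_locales (auto simp: complex_rep_mult[OF assms(2)])
qed

lemma index_rep_tensor:
  assumes "group G" "complex_rep G m \<sigma>" "complex_rep G n \<rho>" "finite (carrier G)"
  shows "index_rep G ({..<m} \<times> {..<n})
    (\<lambda>g p q. \<sigma> g $$ (fst p, fst q) * \<rho> g $$ (snd p, snd q))"
proof -
  interpret group G by fact
  show ?thesis
  proof unfold_locales
    fix g h p q assume gh: "g \<in> carrier G" "h \<in> carrier G" and pq: "p \<in> {..<m} \<times> {..<n}" "q \<in> {..<m} \<times> {..<n}"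
    have "\<sigma> (g \<otimes>\<^bsub>G\<^esub> h) $$ (fst p, fst q) = (\<Sum>k<m. \<sigma> g $$ (fst p, k) * \<sigma> h $$ (k, fst q))"
      using gh pq complex_rep_carrier[OF assms(2)] by (auto simp: complex_rep_mult[OF assms(2)] mat_mult_index_sum[of _ m m _ m])
    moreover have "\<rho> (g \<otimes>\<^bsub>G\<^esub> h) $$ (snd p, snd q) = (\<Sum>k<n. \<rho> g $$ (snd p, k) * \<rho> h $$ (k, snd q))"
      using gh pq complex_rep_carrier[OF assms(3)] by (auto simp: complex_rep_mult[OF assms(3)] mat_mult_index_sum[of _ n n _ n])
    ultimately have "\<sigma> (g \<otimes>\<^bsub>G\<^esub> h) $$ (fst p, fst q) * \<rho> (g \<otimes>\<^bsub>G\<^esub> h) $$ (snd p, snd q)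
      = (\<Sum>k<m. \<Sum>l<n. \<sigma> g $$ (fst p, k) * \<sigma> h $$ (k, fst q) * (\<rho> g $$ (snd p, l) * \<rho> h $$ (l, snd q)))"
      by (simp only: sum_product)
    then show "\<sigma> (g \<otimes>\<^bsub>G\<^esub> h) $$ (fst p, fst q) * \<rho> (g \<otimes>\<^bsub>G\<^esub> h) $$ (snd p, snd q)
      = (\<Sum>k\<in>{..<m} \<times> {..<n}. \<sigma> g $$ (fst p, fst k) * \<rho> g $$ (snd p, snd k)
          * (\<sigma> h $$ (fst k, fst q) * \<rho> h $$ (snd k, snd q)))"
      by (simp add: sum.cartesian_product split_def ac_simps)
  qed (use assms in auto)
qed

text \<open>The mean over \<open>K\<close> of a character is the multiplicity of the trivial character of \<open>K\<close>,
  that is, the dimension of the space of \<open>K\<close>-fixed vectors.\<close>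

definition mean :: "'a set \<Rightarrow> ('a \<Rightarrow> complex) \<Rightarrow> complex" where
  "mean K \<theta> = (\<Sum>g\<in>K. \<theta> g) / card K"

section \<open>Fixed vectors and fixed tensors\<close>

context group
begin

lemma fixed_vec_exists:
  assumes rep: "complex_rep G n \<rho>" and fin: "finite (carrier G)" and K: "subgroup K G"
    and ne: "mean K (character_of G n \<rho>) \<noteq> 0"
  shows "\<exists>v\<in>carrier_vec n. v \<noteq> 0\<^sub>v n \<and> (\<forall>g\<in>K. \<rho> g *\<^sub>v v = v)"
proof -
  interpret K: subgroup K G by fact
  interpret r: index_rep G "{..<n}" "\<lambda>g i j. \<rho> g $$ (i,j)"
    by (rule index_rep_vec[OF is_group rep fin])
  have "(\<Sum>i<n. r.avg K i i) = mean K (character_of G n \<rho>)"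
    unfolding r.trace_avg mean_def by (simp add: character_of_def)
  then obtain x i where x: "r.fixed K x" "i < n" "x i \<noteq> 0"
    using r.fixed_nonzero_exists[OF K] ne by auto
  have c: "\<rho> g \<in> carrier_mat n n" if "g \<in> K" for g
    using complex_rep_carrier[OF rep, of g] that by simp
  have "\<rho> g *\<^sub>v vec n x = vec n x" if g: "g \<in> K" for g
    using x(1) g c[OF g] unfolding r.fixed_def
    by (intro eq_vecI) (auto simp: scalar_prod_def lessThan_atLeast0)
  moreover have "vec n x \<noteq> 0\<^sub>v n" using x(2,3) by (metis index_vec index_zero_vec(1))
  ultimately show ?thesis by (intro bexI[of _ "vec n x"]) auto
qed

text \<open>The tensors fixed by \<open>K\<close>, written as matrices: the first factor acts by
  multiplication from the left, the second by its transpose from the right. Maps of the first factor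
  alone are thus left multiplications.\<close>

definition fixed_mats :: "'a set \<Rightarrow> nat \<Rightarrow> ('a \<Rightarrow> complex mat) \<Rightarrow> nat \<Rightarrow> ('a \<Rightarrow> complex mat) \<Rightarrow> complex mat set" where
  "fixed_mats K m \<sigma> n \<rho> = {X \<in> carrier_mat m n. \<forall>g\<in>K. \<sigma> g * X * (\<rho> g)\<^sup>T = X}"

lemma fixed_mats_iff:
  assumes \<sigma>: "complex_rep G m \<sigma>" and \<rho>: "complex_rep G n \<rho>" and fin: "finite (carrier G)"
    and K: "K \<subseteq> carrier G" and X: "X \<in> carrier_mat m n"
  shows "X \<in> fixed_mats K m \<sigma> n \<rho> \<longleftrightarrow>
    index_rep.fixed ({..<m} \<times> {..<n}) (\<lambda>g p q. \<sigma> g $$ (fst p, fst q) * \<rho> g $$ (snd p, snd q)) K (\<lambda>p. X $$ p)"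
proof -
  have e: "(\<sigma> g * X * (\<rho> g)\<^sup>T) $$ (i,j)
      = (\<Sum>q\<in>{..<m} \<times> {..<n}. \<sigma> g $$ (i, fst q) * \<rho> g $$ (j, snd q) * X $$ q)"
    if g: "g \<in> K" and ij: "i < m" "j < n" for g i j
  proof -
    have c: "\<sigma> g \<in> carrier_mat m m" "\<rho> g \<in> carrier_mat n n"
      using complex_rep_carrier[OF \<sigma>] complex_rep_carrier[OF \<rho>] g K by auto
    have "(\<sigma> g * X * (\<rho> g)\<^sup>T) $$ (i,j) = (\<Sum>k<m. \<sigma> g $$ (i,k) * (\<Sum>l<n. X $$ (k,l) * \<rho> g $$ (j,l)))"
      using c X ij
      by (simp add: mat_mult_index_sum[of _ m n _ n] mat_mult_index_sum[of _ m m _ n] del: index_mult_mat)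
    also have "\<dots> = (\<Sum>k<m. \<Sum>l<n. \<sigma> g $$ (i,k) * \<rho> g $$ (j,l) * X $$ (k,l))"
      by (simp add: sum_distrib_left mult_ac)
    finally show ?thesis by (simp add: sum.cartesian_product split_def)
  qed
  have d: "\<sigma> g * X * (\<rho> g)\<^sup>T \<in> carrier_mat m n" if "g \<in> K" for g
    using complex_rep_carrier[OF \<sigma>] complex_rep_carrier[OF \<rho>] that K X
    by (intro mult_carrier_mat[of _ m n] mult_carrier_mat[of _ m m]) (auto simp: subset_iff)
  have "(\<sigma> g * X * (\<rho> g)\<^sup>T = X) \<longleftrightarrow> (\<forall>p\<in>{..<m} \<times> {..<n}.
      (\<Sum>q\<in>{..<m} \<times> {..<n}. \<sigma> g $$ (fst p, fst q) * \<rho> g $$ (snd p, snd q) * X $$ q) = X $$ p)"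
    if g: "g \<in> K" for g
  proof -
    have "(\<sigma> g * X * (\<rho> g)\<^sup>T = X) \<longleftrightarrow> (\<forall>i<m. \<forall>j<n. (\<sigma> g * X * (\<rho> g)\<^sup>T) $$ (i,j) = X $$ (i,j))"
      using d[OF g] X by (auto intro!: eq_matI)
    then show ?thesis using e[OF g] by auto
  qed
  then show ?thesis
    using X unfolding fixed_mats_def index_rep.fixed_def[OF index_rep_tensor[OF is_group \<sigma> \<rho> fin]] by auto
qed

end

section \<open>Matrices fixed by a subgroup\<close>

lemma mat_eqI_mult_vec:
  fixes A B :: "'a::comm_ring_1 mat"
  assumes A: "A \<in> carrier_mat m n" and B: "B \<in> carrier_mat m n"
    and eq: "\<And>v. v \<in> carrier_vec n \<Longrightarrow> A *\<^sub>v v = B *\<^sub>v v"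
  shows "A = B"
proof (rule eq_matI)
  fix i j assume "i < dim_row B" "j < dim_col B"
  then have ij: "i < m" "j < n" using B by auto
  have "A $$ (i,j) = (A *\<^sub>v unit_vec n j) $ i" using A ij by simp
  also have "\<dots> = B $$ (i,j)" unfolding eq[OF unit_vec_carrier] using B ij by simp
  finally show "A $$ (i,j) = B $$ (i,j)" .
qed (use A B in auto)

lemma mult_mat_zero_vec:
  fixes A :: "'a::comm_ring_1 mat"
  shows "A \<in> carrier_mat m n \<Longrightarrow> A *\<^sub>v 0\<^sub>v n = 0\<^sub>v m"
  by (intro eq_vecI) auto

lemma assoc_mult_mat_five:
  fixes X :: "'a::comm_ring_1 mat"
  assumes "S \<in> carrier_mat m m" "T \<in> carrier_mat m m" "X \<in> carrier_mat m n"
    "A \<in> carrier_mat n n" "B \<in> carrier_mat n n"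
  shows "S * (T * X * A) * B = S * T * X * (A * B)"
proof -
  have TX: "T * X \<in> carrier_mat m n" "S * T \<in> carrier_mat m m" using assms by auto
  have "S * (T * X * A) * B = S * (T * X) * A * B" using assms(1,4) TX by simp
  also have "S * (T * X) = S * T * X" using assms by simp
  also have "S * T * X * A * B = S * T * X * (A * B)"
    by (rule assoc_mult_mat[of _ m n _ n _ n]) (use assms TX in auto)
  finally show ?thesis .
qed

context group
begin

text \<open>The vectors fixed by a normal subgroup form an invariant subspace, so there are none but
  0 or all are fixed. A nonzero mean supplies a nonzero one, and then \<open>D\<close> acts
  trivially.\<close>

lemma mean_irreducible:
  assumes irr: "irreducible_rep G n \<rho>" and fin: "finite (carrier G)" and D: "D \<lhd> G"
  shows "mean D (character_of G n \<rho>)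
    = (if D \<subseteq> char_ker G (character_of G n \<rho>) then of_nat n else 0)"
proof -
  have rep: "complex_rep G n \<rho>" using irr by (simp add: irreducible_rep_def)
  interpret D: normal D G by fact
  note c = complex_rep_carrier[OF rep]
  have fD: "finite D" "D \<noteq> {}" using finite_subset[OF D.subset fin] D.one_closed by blast+
  show ?thesis
  proof (cases "D \<subseteq> char_ker G (character_of G n \<rho>)")
    case True
    then have "character_of G n \<rho> g = of_nat n" if "g \<in> D" for g
      using that character_of_one[OF rep] by (auto simp: char_ker_def)
    then show ?thesis using True fD by (simp add: mean_def)
  next
    case False
    have "mean D (character_of G n \<rho>) = 0"
    proof (rule ccontr)
      assume ne: "mean D (character_of G n \<rho>) \<noteq> 0"
      let ?W = "{v \<in> carrier_vec n. \<forall>g\<in>D. \<rho> g *\<^sub>v v = v}"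
      have "?W = {0\<^sub>v n} \<or> ?W = carrier_vec n"
      proof (rule irreducible_rep_subspace[OF irr])
        fix g v assume g: "g \<in> carrier G" and v: "v \<in> ?W"
        have "\<rho> d *\<^sub>v (\<rho> g *\<^sub>v v) = \<rho> g *\<^sub>v v" if d: "d \<in> D" for d
        proof -
          have "\<rho> d * \<rho> g = \<rho> g * \<rho> (inv g \<otimes> d \<otimes> g)"
            using g d by (simp add: complex_rep_mult[OF rep, symmetric] m_assoc inv_cancel)
          moreover have "inv g \<otimes> d \<otimes> g \<in> D" using D.inv_op_closed1 g d by simp
          ultimately show ?thesis using c g d v by (simp add: assoc_mult_mat_vec[of _ n n _ n, symmetric])
              (simp add: assoc_mult_mat_vec[of _ n n _ n])
        qed
        then show "\<rho> g *\<^sub>v v \<in> ?W" using c[OF g] v by auto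
      qed (use c in \<open>auto simp: mult_add_distrib_mat_vec[of _ n n] mult_mat_vec[of _ n n] mult_mat_zero_vec[of _ n n]\<close>)
      moreover have "?W \<noteq> {0\<^sub>v n}" using fixed_vec_exists[OF rep fin D.subgroup_axioms ne] by auto
      ultimately have W: "?W = carrier_vec n" by blast
      have "\<rho> d = 1\<^sub>m n" if d: "d \<in> D" for d
        by (rule mat_eqI_mult_vec[of _ n n]) (use W c d in auto)
      then show False
        using False char_ker_character_of[OF rep fin] by (auto simp: kernel_def GL_simps)
    qed
    then show ?thesis using False by simp
  qed
qed

text \<open>The product of the characters is the trace on the tensor product, so its mean is the
  trace of the averaging projection there.\<close>

lemma mean_mult_eq:
  assumes \<sigma>: "complex_rep G m \<sigma>" and \<rho>: "complex_rep G n \<rho>" and fin: "finite (carrier G)"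
    and K: "K \<subseteq> carrier G"
  shows "mean K (\<lambda>g. character_of G m \<sigma> g * character_of G n \<rho> g)
    = (\<Sum>p\<in>{..<m} \<times> {..<n}. index_rep.avg (\<lambda>g p q. \<sigma> g $$ (fst p, fst q) * \<rho> g $$ (snd p, snd q)) K p p)"
proof -
  interpret t: index_rep G "{..<m} \<times> {..<n}" "\<lambda>g p q. \<sigma> g $$ (fst p, fst q) * \<rho> g $$ (snd p, snd q)"
    by (rule index_rep_tensor[OF is_group \<sigma> \<rho> fin])
  show ?thesis
    unfolding t.trace_avg mean_def using K
    by (intro arg_cong[where f = "\<lambda>x. x / _"] sum.cong)
      (auto simp: character_of_def sum_product sum.cartesian_product split_def)
qed

lemma fixed_mats_nonzero_exists:
  assumes \<sigma>: "complex_rep G m \<sigma>" and \<rho>: "complex_rep G n \<rho>" and fin: "finite (carrier G)"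
    and K: "subgroup K G"
    and ne: "mean K (\<lambda>g. character_of G m \<sigma> g * character_of G n \<rho> g) \<noteq> 0"
  shows "\<exists>X\<in>fixed_mats K m \<sigma> n \<rho>. X \<noteq> 0\<^sub>m m n"
proof -
  interpret t: index_rep G "{..<m} \<times> {..<n}" "\<lambda>g p q. \<sigma> g $$ (fst p, fst q) * \<rho> g $$ (snd p, snd q)"
    by (rule index_rep_tensor[OF is_group \<sigma> \<rho> fin])
  note KG = subgroup.subset[OF K]
  obtain x p where x: "t.fixed K x" "p \<in> {..<m} \<times> {..<n}" "x p \<noteq> 0"
    using t.fixed_nonzero_exists[OF K] ne unfolding mean_mult_eq[OF \<sigma> \<rho> fin KG] by blast
  let ?X = "mat m n x"
  have "t.fixed K (\<lambda>p. ?X $$ p)"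
  proof -
    have "?X $$ q = x q" if "q \<in> {..<m} \<times> {..<n}" for q using that by auto
    then show ?thesis using x(1) unfolding t.fixed_def by (simp cong: sum.cong)
  qed
  then have "?X \<in> fixed_mats K m \<sigma> n \<rho>" using fixed_mats_iff[OF \<sigma> \<rho> fin KG, of ?X] by simp
  moreover have "?X \<noteq> 0\<^sub>m m n"
  proof
    assume "?X = 0\<^sub>m m n"
    then have "?X $$ p = 0\<^sub>m m n $$ p" by simp
    then show False using x by auto
  qed
  ultimately show ?thesis by blast
qed

text \<open>Matrices fixed by \<open>K\<close> are fixed by \<open>D\<close>, and the two means are
  the dimensions of the two spaces.\<close>

lemma fixed_mats_eq_if_mean_eq:
  assumes \<sigma>: "complex_rep G m \<sigma>" and \<rho>: "complex_rep G n \<rho>" and fin: "finite (carrier G)"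
    and K: "subgroup K G" and D: "subgroup D G" "D \<subseteq> K"
    and eq: "mean D (\<lambda>g. character_of G m \<sigma> g * character_of G n \<rho> g)
      = mean K (\<lambda>g. character_of G m \<sigma> g * character_of G n \<rho> g)"
    and X: "X \<in> fixed_mats D m \<sigma> n \<rho>"
  shows "X \<in> fixed_mats K m \<sigma> n \<rho>"
proof -
  interpret t: index_rep G "{..<m} \<times> {..<n}" "\<lambda>g p q. \<sigma> g $$ (fst p, fst q) * \<rho> g $$ (snd p, snd q)"
    by (rule index_rep_tensor[OF is_group \<sigma> \<rho> fin])
  note KG = subgroup.subset[OF K] and DG = subgroup.subset[OF D(1)]
  have c: "X \<in> carrier_mat m n" using X by (simp add: fixed_mats_def)
  show ?thesis
    using X t.fixed_if_trace_eq[OF K D] eq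
    unfolding mean_mult_eq[OF \<sigma> \<rho> fin KG] mean_mult_eq[OF \<sigma> \<rho> fin DG]
      fixed_mats_iff[OF \<sigma> \<rho> fin KG c] fixed_mats_iff[OF \<sigma> \<rho> fin DG c] by blast
qed

lemma fixed_mats_zero_if_mean_zero:
  assumes \<sigma>: "complex_rep G m \<sigma>" and \<rho>: "complex_rep G n \<rho>" and fin: "finite (carrier G)"
    and K: "subgroup K G"
    and eq: "mean K (\<lambda>g. character_of G m \<sigma> g * character_of G n \<rho> g) = 0"
    and X: "X \<in> fixed_mats K m \<sigma> n \<rho>"
  shows "X = 0\<^sub>m m n"
proof -
  interpret t: index_rep G "{..<m} \<times> {..<n}" "\<lambda>g p q. \<sigma> g $$ (fst p, fst q) * \<rho> g $$ (snd p, snd q)"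
    by (rule index_rep_tensor[OF is_group \<sigma> \<rho> fin])
  note KG = subgroup.subset[OF K]
  have c: "X \<in> carrier_mat m n" using X by (simp add: fixed_mats_def)
  have "X $$ p = 0" if "p \<in> {..<m} \<times> {..<n}" for p
    using X t.fixed_zero_if_trace_zero[OF K _ _ that] eq
    unfolding mean_mult_eq[OF \<sigma> \<rho> fin KG] fixed_mats_iff[OF \<sigma> \<rho> fin KG c] by blast
  then show ?thesis using c by (intro eq_matI) auto
qed

text \<open>The columns of the matrices fixed by a normal subgroup span a \<open>\<sigma>\<close>-invariant subspace. The
  double annihilator below stands for that span.\<close>

lemma annihilator_fixed_mats_zero:
  assumes irr: "irreducible_rep G m \<sigma>" and \<rho>: "complex_rep G n \<rho>"
    and N: "N \<lhd> G" and X0: "X0 \<in> fixed_mats N m \<sigma> n \<rho>" "X0 \<noteq> 0\<^sub>m m n"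
    and M: "M \<in> carrier_mat m m" and ann: "\<And>X. X \<in> fixed_mats N m \<sigma> n \<rho> \<Longrightarrow> M * X = 0\<^sub>m m n"
  shows "M = 0\<^sub>m m m"
proof -
  have \<sigma>: "complex_rep G m \<sigma>" using irr by (simp add: irreducible_rep_def)
  interpret N: normal N G by fact
  note cs = complex_rep_carrier[OF \<sigma>] and cr = complex_rep_carrier[OF \<rho>]
  let ?F = "fixed_mats N m \<sigma> n \<rho>"
  have FX: "X \<in> carrier_mat m n" if "X \<in> ?F" for X using that by (simp add: fixed_mats_def)
  \<comment> \<open>Normality of \<open>N\<close>: moving \<open>h\<close> past \<open>g\<close>
    replaces it by a conjugate that is again in \<open>N\<close>.\<close>
  have moved: "\<sigma> g * X * (\<rho> g)\<^sup>T \<in> ?F" if g: "g \<in> carrier G" and X: "X \<in> ?F" for g X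
  proof -
    have "\<sigma> h * (\<sigma> g * X * (\<rho> g)\<^sup>T) * (\<rho> h)\<^sup>T = \<sigma> g * X * (\<rho> g)\<^sup>T" if h: "h \<in> N" for h
    proof -
      let ?h = "inv g \<otimes> h \<otimes> g"
      have hN: "?h \<in> N" using N.inv_op_closed1 g h by simp
      have hg: "h \<in> carrier G" "?h \<in> carrier G" using h g by auto
      have e: "h \<otimes> g = g \<otimes> ?h" using g h by (simp add: m_assoc inv_cancel)
      have s: "\<sigma> h * \<sigma> g = \<sigma> g * \<sigma> ?h"
        using e complex_rep_mult[OF \<sigma>] hg g by metis
      have "\<rho> h * \<rho> g = \<rho> g * \<rho> ?h"
        using e complex_rep_mult[OF \<rho>] hg g by metis
      then have t: "(\<rho> g)\<^sup>T * (\<rho> h)\<^sup>T = (\<rho> ?h)\<^sup>T * (\<rho> g)\<^sup>T"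
        using cr hg g by (metis transpose_mult)
      have "\<sigma> h * (\<sigma> g * X * (\<rho> g)\<^sup>T) * (\<rho> h)\<^sup>T = (\<sigma> h * \<sigma> g) * X * ((\<rho> g)\<^sup>T * (\<rho> h)\<^sup>T)"
        by (rule assoc_mult_mat_five) (use cs cr hg g FX[OF X] in auto)
      also have "\<dots> = \<sigma> g * (\<sigma> ?h * X * (\<rho> ?h)\<^sup>T) * (\<rho> g)\<^sup>T"
        unfolding s t by (rule assoc_mult_mat_five[symmetric]) (use cs cr hg g FX[OF X] in auto)
      also have "\<sigma> ?h * X * (\<rho> ?h)\<^sup>T = X" using X hN by (simp add: fixed_mats_def)
      finally show ?thesis .
    qed
    moreover have "\<sigma> g * X * (\<rho> g)\<^sup>T \<in> carrier_mat m n"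
      using cs[OF g] cr[OF g] FX[OF X] by (intro mult_carrier_mat[of _ m n] mult_carrier_mat[of _ m m]) auto
    ultimately show ?thesis by (simp add: fixed_mats_def)
  qed
  let ?A = "{M \<in> carrier_mat m m. \<forall>X\<in>?F. M * X = 0\<^sub>m m n}"
  let ?W = "{w \<in> carrier_vec m. \<forall>M\<in>?A. M *\<^sub>v w = 0\<^sub>v m}"
  \<comment> \<open>As \<open>G\<close> moves fixed matrices to fixed matrices, \<open>?A\<close> is
    stable under right multiplication by \<open>\<sigma> g\<close>, which makes \<open>?W\<close>
    invariant.\<close>
  have A\<sigma>: "M * \<sigma> g \<in> ?A" if M: "M \<in> ?A" and g: "g \<in> carrier G" for M g
  proof -
    have "M * \<sigma> g * X = 0\<^sub>m m n" if X: "X \<in> ?F" for X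
    proof -
      \<comment> \<open>Inserting this product completes \<open>\<sigma> g * X\<close> to the
        translate of \<open>X\<close> by \<open>g\<close>, which \<open>M\<close> kills.\<close>
      have r: "(\<rho> g)\<^sup>T * (\<rho> (inv g))\<^sup>T = 1\<^sub>m n"
        using cr[OF g] cr[OF inv_closed[OF g]] complex_rep_inv(1)[OF \<rho> g]
        by (metis transpose_mult transpose_one)
      have "M * \<sigma> g * X = M * \<sigma> g * X * ((\<rho> g)\<^sup>T * (\<rho> (inv g))\<^sup>T)"
        unfolding r using M cs[OF g] FX[OF X] by (metis (no_types, lifting) mem_Collect_eq mult_carrier_mat right_mult_one_mat)
      also have "\<dots> = M * (\<sigma> g * X * (\<rho> g)\<^sup>T) * (\<rho> (inv g))\<^sup>T"
        by (rule assoc_mult_mat_five[symmetric]) (use M cs[OF g] cr[OF g] cr[OF inv_closed[OF g]] FX[OF X] in auto)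
      also have "M * (\<sigma> g * X * (\<rho> g)\<^sup>T) = 0\<^sub>m m n" using M moved[OF g X] by simp
      finally show ?thesis using cr[OF inv_closed[OF g]] by simp
    qed
    then show ?thesis using M cs[OF g] by auto
  qed
  have "?W = {0\<^sub>v m} \<or> ?W = carrier_vec m"
  proof (rule irreducible_rep_subspace[OF irr])
    fix g v assume g: "g \<in> carrier G" and v: "v \<in> ?W"
    have "M *\<^sub>v (\<sigma> g *\<^sub>v v) = 0\<^sub>v m" if M: "M \<in> ?A" for M
      using A\<sigma>[OF M g] v M cs[OF g] assoc_mult_mat_vec[of M m m "\<sigma> g" m v] by auto
    then show "\<sigma> g *\<^sub>v v \<in> ?W" using cs[OF g] v by auto
  qed (auto simp: mult_add_distrib_mat_vec[of _ m m] mult_mat_vec[of _ m m] mult_mat_zero_vec[of _ m m])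
  \<comment> \<open>The columns of \<open>X0\<close> lie in \<open>?W\<close>, and they are not all
    zero.\<close>
  moreover have "?W \<noteq> {0\<^sub>v m}"
  proof
    assume W0: "?W = {0\<^sub>v m}"
    have "col X0 j = 0\<^sub>v m" if j: "j < n" for j
    proof -
      have "M *\<^sub>v col X0 j = 0\<^sub>v m" if "M \<in> ?A" for M
      proof -
        have "M *\<^sub>v col X0 j = col (M * X0) j"
          by (rule col_mult2[symmetric]) (use that FX[OF X0(1)] j in auto)
        then show ?thesis using that X0(1) j by simp
      qed
      then have "col X0 j \<in> ?W" using FX[OF X0(1)] j by auto
      then show ?thesis using W0 by blast
    qed
    then have "X0 $$ (i,j) = 0" if "i < m" "j < n" for i j
      using that FX[OF X0(1)] by (metis carrier_matD index_col index_zero_vec(1))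
    then show False using X0(2) FX[OF X0(1)] by (auto intro!: eq_matI)
  qed
  ultimately have "?W = carrier_vec m" by blast
  moreover have "M \<in> ?A" using M ann by simp
  ultimately have "M *\<^sub>v w = 0\<^sub>v m" if "w \<in> carrier_vec m" for w using that by blast
  then show ?thesis using M by (intro mat_eqI_mult_vec[of _ m m]) auto
qed

end

section \<open>Orthogonality and constituents\<close>

lemma Irr_cases:
  assumes "\<beta> \<in> Irr G"
  obtains n \<rho> where "irreducible_rep G n \<rho>" "complex_rep G n \<rho>" "n > 0" "\<beta> = character_of G n \<rho>"
  using assms by (auto simp: Irr_def irreducible_rep_def)

section \<open>Commutation on an irreducible tensor factor\<close>

context group
begin

text \<open>If \<open>\<sigma> y\<close> commutes with the second derived subgroup of
  \<open>N\<close>, it preserves the tensors fixed by that subgroup. By \<open>eq\<close> these are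
  the tensors fixed by \<open>N\<close>, by \<open>ne\<close> some are nonzero, and irreducibility
  of \<open>\<sigma>\<close> extends commutation from them to the whole space.\<close>

lemma derived_trivial_if_mean_eq:
  assumes ss: "supersolvable G" and fin: "finite (carrier G)" and N: "N \<lhd> G"
    and irr: "irreducible_rep G m \<sigma>" and \<rho>: "complex_rep G n \<rho>"
    and eq: "mean (derived G (derived G N)) (\<lambda>g. character_of G m \<sigma> g * character_of G n \<rho> g)
      = mean N (\<lambda>g. character_of G m \<sigma> g * character_of G n \<rho> g)"
    and ne: "mean N (\<lambda>g. character_of G m \<sigma> g * character_of G n \<rho> g) \<noteq> 0"
    and x: "x \<in> derived G N"
  shows "\<sigma> x = 1\<^sub>m m"
proof -
  have \<sigma>: "complex_rep G m \<sigma>" using irr by (simp add: irreducible_rep_def)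
  interpret N: normal N G by fact
  interpret h: group_hom G "GL m" \<sigma> by (rule complex_rep_group_hom[OF \<sigma>])
  let ?D = "derived G (derived G N)"
  have N'N: "derived G N \<subseteq> N" by (rule derived_incl[OF order_refl N.subgroup_axioms])
  have N': "subgroup (derived G N) G" by (rule derived_is_subgroup[OF N.subset])
  have D: "subgroup ?D G" by (rule derived_is_subgroup[OF subgroup.subset[OF N']])
  have DN: "?D \<subseteq> N" using derived_incl[OF order_refl N'] N'N by blast
  obtain X0 where X0: "X0 \<in> fixed_mats N m \<sigma> n \<rho>" "X0 \<noteq> 0\<^sub>m m n"
    using fixed_mats_nonzero_exists[OF \<sigma> \<rho> fin N.subgroup_axioms ne] by blast
  note cs = complex_rep_carrier[OF \<sigma>] and cr = complex_rep_carrier[OF \<rho>]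
  have "\<sigma> x = \<one>\<^bsub>GL m\<^esub>"
  proof (rule h.derived_in_kernel_if_supersolvable[OF ss N _ x])
    fix y z assume y: "y \<in> carrier G" and z: "z \<in> N"
      and comm: "\<And>d. d \<in> ?D \<Longrightarrow> \<sigma> y \<otimes>\<^bsub>GL m\<^esub> \<sigma> d = \<sigma> d \<otimes>\<^bsub>GL m\<^esub> \<sigma> y"
    have sy: "\<sigma> y \<in> carrier_mat m m" and sz: "\<sigma> z \<in> carrier_mat m m"
      and rz: "(\<rho> z)\<^sup>T \<in> carrier_mat n n" and rz': "(\<rho> (inv z))\<^sup>T \<in> carrier_mat n n"
      using cs cr y z by auto
    have R: "(\<rho> z)\<^sup>T * (\<rho> (inv z))\<^sup>T = 1\<^sub>m n"
      using cr[of z] cr[of "inv z"] complex_rep_inv(1)[OF \<rho>, of z] z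
      by (metis N.mem_carrier inv_closed transpose_mult transpose_one)
    \<comment> \<open>By the annihilator lemma this commutator vanishes as soon as it kills every
      matrix fixed by \<open>N\<close>.\<close>
    let ?M = "\<sigma> y * \<sigma> z - \<sigma> z * \<sigma> y"
    have M: "?M \<in> carrier_mat m m" using sy sz by auto
    have "?M * X = 0\<^sub>m m n" if X: "X \<in> fixed_mats N m \<sigma> n \<rho>" for X
    proof -
      have cX: "X \<in> carrier_mat m n" and yX: "\<sigma> y * X \<in> carrier_mat m n"
        using X sy by (auto simp: fixed_mats_def)
      have fX: "\<sigma> g * X * (\<rho> g)\<^sup>T = X" if "g \<in> N" for g using X that by (simp add: fixed_mats_def)
      have "\<sigma> d * (\<sigma> y * X) * (\<rho> d)\<^sup>T = \<sigma> y * X" if d: "d \<in> ?D" for d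
      proof -
        have dN: "d \<in> N" using d DN by blast
        have sd: "\<sigma> d \<in> carrier_mat m m" "(\<rho> d)\<^sup>T \<in> carrier_mat n n" using cs cr dN by auto
        have "\<sigma> d * (\<sigma> y * X) = \<sigma> y * (\<sigma> d * X)"
          using comm[OF d] assoc_mult_mat[OF sd(1) sy cX] assoc_mult_mat[OF sy sd(1) cX]
          by (simp add: GL_simps)
        moreover have "\<sigma> d * X \<in> carrier_mat m n" using sd cX by simp
        ultimately have "\<sigma> d * (\<sigma> y * X) * (\<rho> d)\<^sup>T = \<sigma> y * (\<sigma> d * X * (\<rho> d)\<^sup>T)"
          using sy sd by simp
        then show ?thesis unfolding fX[OF dN] .
      qed
      then have "\<sigma> y * X \<in> fixed_mats ?D m \<sigma> n \<rho>" using yX by (simp add: fixed_mats_def)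
      then have "\<sigma> y * X \<in> fixed_mats N m \<sigma> n \<rho>"
        using fixed_mats_eq_if_mean_eq[OF \<sigma> \<rho> fin N.subgroup_axioms D DN eq] by blast
      \<comment> \<open>Both \<open>\<sigma> z * (\<sigma> y * X)\<close> and
        \<open>\<sigma> y * (\<sigma> z * X)\<close> become \<open>\<sigma> y * X\<close> when
        multiplied on the right by the transpose of \<open>\<rho> z\<close>, which is
        invertible.\<close>
      then have 1: "\<sigma> z * (\<sigma> y * X) * (\<rho> z)\<^sup>T = \<sigma> y * X" using z by (simp add: fixed_mats_def)
      have zX: "\<sigma> z * X \<in> carrier_mat m n" using sz cX by simp
      have 2: "\<sigma> y * (\<sigma> z * X) * (\<rho> z)\<^sup>T = \<sigma> y * X"
        using assoc_mult_mat[OF sy zX rz] fX[OF z] by simp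
      have cancel: "Z = Z * (\<rho> z)\<^sup>T * (\<rho> (inv z))\<^sup>T" if "Z \<in> carrier_mat m n" for Z
        using assoc_mult_mat[OF that rz rz'] R that by simp
      have "\<sigma> y * (\<sigma> z * X) \<in> carrier_mat m n" "\<sigma> z * (\<sigma> y * X) \<in> carrier_mat m n"
        using sy sz zX yX by auto
      then have "\<sigma> y * (\<sigma> z * X) = \<sigma> z * (\<sigma> y * X)"
        using 1 2 cancel by metis
      moreover have "?M * X = \<sigma> y * (\<sigma> z * X) - \<sigma> z * (\<sigma> y * X)"
        using sy sz cX by (subst minus_mult_distrib_mat[of _ m m _ _ n]) auto
      moreover have "\<sigma> z * (\<sigma> y * X) - \<sigma> z * (\<sigma> y * X) = 0\<^sub>m m n"
        using sz yX by (intro eq_matI) auto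
      ultimately show ?thesis by simp
    qed
    then have "?M = 0\<^sub>m m m" by (rule annihilator_fixed_mats_zero[OF irr \<rho> N X0 M])
    then have "\<sigma> y * \<sigma> z = \<sigma> z * \<sigma> y"
    proof (intro eq_matI)
      fix i j assume "i < dim_row (\<sigma> z * \<sigma> y)" "j < dim_col (\<sigma> z * \<sigma> y)"
      then have ij: "i < m" "j < m" using sy sz by auto
      then show "(\<sigma> y * \<sigma> z) $$ (i,j) = (\<sigma> z * \<sigma> y) $$ (i,j)"
        using arg_cong[OF \<open>?M = 0\<^sub>m m m\<close>, of "\<lambda>B. B $$ (i,j)"] sy sz by simp
    qed (use sy sz in auto)
    then show "\<sigma> y \<otimes>\<^bsub>GL m\<^esub> \<sigma> z = \<sigma> z \<otimes>\<^bsub>GL m\<^esub> \<sigma> y" by (simp add: GL_simps)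
  qed
  then show ?thesis by (simp add: GL_simps)
qed

text \<open>Schur's lemma: the kernel and the image of an intertwiner are invariant subspaces, so a
  nonzero one is injective and surjective.\<close>

lemma irreducible_intertwiner_invertible:
  assumes \<sigma>: "irreducible_rep G m \<sigma>" and \<rho>: "irreducible_rep G n \<rho>"
    and X: "X \<in> carrier_mat m n" "X \<noteq> 0\<^sub>m m n"
    and int: "\<And>g. g \<in> carrier G \<Longrightarrow> \<sigma> g * X = X * \<rho> g"
  shows "\<exists>Y\<in>carrier_mat n m. X * Y = 1\<^sub>m m \<and> Y * X = 1\<^sub>m n"
proof -
  have cs: "\<And>g. g \<in> carrier G \<Longrightarrow> \<sigma> g \<in> carrier_mat m m"
    and cr: "\<And>g. g \<in> carrier G \<Longrightarrow> \<rho> g \<in> carrier_mat n n"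
    using complex_rep_carrier \<sigma> \<rho> by (auto simp: irreducible_rep_def)
  have intv: "\<sigma> g *\<^sub>v (X *\<^sub>v v) = X *\<^sub>v (\<rho> g *\<^sub>v v)" if "g \<in> carrier G" "v \<in> carrier_vec n" for g v
    using int[OF that(1)] assoc_mult_mat_vec[OF cs[OF that(1)] X(1) that(2)]
      assoc_mult_mat_vec[OF X(1) cr[OF that(1)] that(2)] by simp
  have X0: "\<exists>v\<in>carrier_vec n. X *\<^sub>v v \<noteq> 0\<^sub>v m"
  proof (rule ccontr)
    assume "\<not> ?thesis"
    then have "X = 0\<^sub>m m n" using X(1) by (intro mat_eqI_mult_vec[of _ m n]) auto
    then show False using X(2) by blast
  qed
  let ?K = "{v \<in> carrier_vec n. X *\<^sub>v v = 0\<^sub>v m}"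
  have "?K = {0\<^sub>v n} \<or> ?K = carrier_vec n"
  proof (rule irreducible_rep_subspace[OF \<rho>])
    fix g v assume "g \<in> carrier G" "v \<in> ?K"
    then show "\<rho> g *\<^sub>v v \<in> ?K"
      using intv[of g v] cr[of g] mult_mat_zero_vec[OF cs[of g]] by auto
  qed (use X(1) in \<open>auto simp: mult_add_distrib_mat_vec[of _ m n] mult_mat_vec[of _ m n] mult_mat_zero_vec[of _ m n]\<close>)
  then have ker: "?K = {0\<^sub>v n}" using X0 by blast
  let ?I = "(\<lambda>v. X *\<^sub>v v) ` carrier_vec n"
  have "?I = {0\<^sub>v m} \<or> ?I = carrier_vec m"
  proof (rule irreducible_rep_subspace[OF \<sigma>])
    show "?I \<subseteq> carrier_vec m" using X(1) by auto
    show "0\<^sub>v m \<in> ?I" using mult_mat_zero_vec[OF X(1)] by (metis image_eqI zero_carrier_vec)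
    show "v + w \<in> ?I" if "v \<in> ?I" "w \<in> ?I" for v w
      using that mult_add_distrib_mat_vec[OF X(1)] by clarify (metis add_carrier_vec image_eqI)
    show "c \<cdot>\<^sub>v v \<in> ?I" if "v \<in> ?I" for c v
      using that mult_mat_vec[OF X(1)] by clarify (metis smult_carrier_vec image_eqI)
    show "\<sigma> g *\<^sub>v v \<in> ?I" if "g \<in> carrier G" "v \<in> ?I" for g v
      using that intv cr[OF that(1)] by clarify (metis mult_mat_vec_carrier image_eqI)
  qed
  then have im: "?I = carrier_vec m" using X0 by blast
  then have "\<forall>j<m. \<exists>v\<in>carrier_vec n. X *\<^sub>v v = unit_vec m j"
    by (metis (no_types, lifting) imageE unit_vec_carrier)
  then obtain w where w: "\<And>j. j < m \<Longrightarrow> w j \<in> carrier_vec n" "\<And>j. j < m \<Longrightarrow> X *\<^sub>v w j = unit_vec m j"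
    by metis
  \<comment> \<open>The columns are preimages of the unit vectors, which gives a right inverse;
    injectivity of \<open>X\<close> makes it a left inverse as well.\<close>
  define Y where "Y = mat_of_cols n (map w [0..<m])"
  have Y: "Y \<in> carrier_mat n m"
    using mat_of_cols_carrier(1)[of n "map w [0..<m]"] by (simp add: Y_def)
  have cY: "col Y j = w j" if "j < m" for j
    using that w(1) by (simp add: Y_def)
  have XY: "X * Y = 1\<^sub>m m"
  proof (rule eq_matI)
    fix i j assume "i < dim_row (1\<^sub>m m)" "j < dim_col (1\<^sub>m m)"
    then have ij: "i < m" "j < m" by auto
    have "(X * Y) $$ (i,j) = (X *\<^sub>v col Y j) $ i" using X(1) Y ij by simp
    also have "\<dots> = 1\<^sub>m m $$ (i,j)" unfolding cY[OF ij(2)] w(2)[OF ij(2)] using ij by simp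
    finally show "(X * Y) $$ (i,j) = 1\<^sub>m m $$ (i,j)" .
  qed (use X Y in auto)
  have "Y * X = 1\<^sub>m n"
  proof (rule mat_eqI_mult_vec)
    show "Y * X \<in> carrier_mat n n" "1\<^sub>m n \<in> carrier_mat n n" using X Y by auto
    fix v :: "complex vec" assume v: "v \<in> carrier_vec n"
    have yv: "Y *\<^sub>v (X *\<^sub>v v) \<in> carrier_vec n" using X Y v by auto
    have xv: "X *\<^sub>v v \<in> carrier_vec m" using X v by auto
    have "X *\<^sub>v (Y *\<^sub>v (X *\<^sub>v v)) = X *\<^sub>v v"
      using assoc_mult_mat_vec[OF X(1) Y xv] XY xv by simp
    then have "X *\<^sub>v (Y *\<^sub>v (X *\<^sub>v v) - v) = 0\<^sub>v m"
      using mult_minus_distrib_mat_vec[OF X(1) yv v] xv by simp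
    then have "Y *\<^sub>v (X *\<^sub>v v) - v \<in> ?K" using yv v by auto
    then have d: "Y *\<^sub>v (X *\<^sub>v v) - v = 0\<^sub>v n" unfolding ker by blast
    have "Y *\<^sub>v (X *\<^sub>v v) = v"
    proof (rule eq_vecI)
      fix i assume "i < dim_vec v"
      then show "(Y *\<^sub>v (X *\<^sub>v v)) $ i = v $ i"
        using arg_cong[OF d, of "\<lambda>u. u $ i"] v yv by simp
    qed (use Y v in auto)
    then show "Y * X *\<^sub>v v = 1\<^sub>m n *\<^sub>v v" using assoc_mult_mat_vec[OF Y X(1) v] v by simp
  qed
  then show ?thesis using XY Y by blast
qed

section \<open>Orthogonality of irreducible characters\<close>

lemma character_of_contragredient:
  assumes "complex_rep G n \<rho>" "g \<in> carrier G"
  shows "character_of G n (\<lambda>g. (\<rho> (inv g))\<^sup>T) g = character_of G n \<rho> (inv g)"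
  using complex_rep_carrier[OF assms(1) inv_closed[OF assms(2)]] assms(2)
  by (simp add: character_of_def)

lemma fixed_mats_contragredient:
  assumes \<sigma>: "complex_rep G m \<sigma>" and \<rho>: "complex_rep G n \<rho>"
    and X: "X \<in> fixed_mats (carrier G) m \<sigma> n (\<lambda>g. (\<rho> (inv g))\<^sup>T)" and g: "g \<in> carrier G"
  shows "\<sigma> g * X = X * \<rho> g"
proof -
  have cX: "X \<in> carrier_mat m n" using X by (simp add: fixed_mats_def)
  note c = complex_rep_carrier[OF \<sigma> g] complex_rep_carrier[OF \<rho> g] complex_rep_carrier[OF \<rho> inv_closed[OF g]]
  have sX: "\<sigma> g * X \<in> carrier_mat m n" using c cX by simp
  have "\<sigma> g * X = \<sigma> g * X * (\<rho> (inv g) * \<rho> g)"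
    using right_mult_one_mat[OF sX] complex_rep_inv(1)[OF \<rho> g] by simp
  also have "\<dots> = \<sigma> g * X * \<rho> (inv g) * \<rho> g"
    using assoc_mult_mat[OF sX c(3,2)] by simp
  also have "\<sigma> g * X * \<rho> (inv g) = X" using X g by (simp add: fixed_mats_def)
  finally show ?thesis .
qed

text \<open>The inner product of characters; \<open>\<psi> (inv g)\<close> stands for the complex
  conjugate of \<open>\<psi> g\<close>, to which it is equal for characters of a finite
  group.\<close>

definition pairing :: "('a \<Rightarrow> complex) \<Rightarrow> ('a \<Rightarrow> complex) \<Rightarrow> complex" where
  "pairing \<theta> \<psi> = mean (carrier G) (\<lambda>g. \<theta> g * \<psi> (inv g))"

lemma pairing_character_of:
  assumes "complex_rep G n \<rho>"
  shows "pairing \<theta> (character_of G n \<rho>)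
    = mean (carrier G) (\<lambda>g. \<theta> g * character_of G n (\<lambda>g. (\<rho> (inv g))\<^sup>T) g)"
  unfolding pairing_def mean_def using character_of_contragredient[OF assms] by simp

text \<open>The pairing is the dimension of the space of intertwiners. A nonzero intertwiner is
  invertible and forces equal traces; for equal characters the identity matrix is one.\<close>

lemma pairing_irreducible_eq_0_iff:
  assumes "finite (carrier G)" "\<beta> \<in> Irr G" "\<gamma> \<in> Irr G"
  shows "pairing \<beta> \<gamma> = 0 \<longleftrightarrow> \<beta> \<noteq> \<gamma>"
proof -
  note fin = assms(1)
  obtain m \<sigma> where irr_\<sigma>: "irreducible_rep G m \<sigma>" and \<sigma>: "complex_rep G m \<sigma>" and m: "m > 0"
    and \<beta>: "\<beta> = character_of G m \<sigma>"
    using Irr_cases[OF assms(2)] .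
  obtain n \<rho> where irr_\<rho>: "irreducible_rep G n \<rho>" and \<rho>: "complex_rep G n \<rho>"
    and \<gamma>: "\<gamma> = character_of G n \<rho>"
    using Irr_cases[OF assms(3)] .
  show ?thesis
  proof
    assume "pairing \<beta> \<gamma> = 0"
    show "\<beta> \<noteq> \<gamma>"
    proof
      assume "\<beta> = \<gamma>"
      then have "mean (carrier G) (\<lambda>g. character_of G m \<sigma> g
          * character_of G m (\<lambda>g. (\<sigma> (inv g))\<^sup>T) g) = 0"
        using \<open>pairing \<beta> \<gamma> = 0\<close> pairing_character_of[OF \<sigma>, of \<beta>] \<beta> by simp
      moreover have "1\<^sub>m m \<in> fixed_mats (carrier G) m \<sigma> m (\<lambda>g. (\<sigma> (inv g))\<^sup>T)"
        using complex_rep_inv(2)[OF \<sigma>] complex_rep_carrier[OF \<sigma>]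
        by (auto simp: fixed_mats_def) (metis right_mult_one_mat)
      ultimately have "1\<^sub>m m = (0\<^sub>m m m :: complex mat)"
        by (rule fixed_mats_zero_if_mean_zero[OF \<sigma> contragredient[OF \<sigma>] fin subgroup_self])
      then have "1\<^sub>m m $$ (0,0) = (0\<^sub>m m m :: complex mat) $$ (0,0)" by simp
      then show False using m by simp
    qed
  next
    assume "\<beta> \<noteq> \<gamma>"
    show "pairing \<beta> \<gamma> = 0"
    proof (rule ccontr)
      assume "pairing \<beta> \<gamma> \<noteq> 0"
      then obtain X where X: "X \<in> fixed_mats (carrier G) m \<sigma> n (\<lambda>g. (\<rho> (inv g))\<^sup>T)" "X \<noteq> 0\<^sub>m m n"
        using fixed_mats_nonzero_exists[OF \<sigma> contragredient[OF \<rho>] fin subgroup_self]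
        unfolding \<beta> \<gamma> pairing_character_of[OF \<rho>] by blast
      have cX: "X \<in> carrier_mat m n" using X by (simp add: fixed_mats_def)
      note int = fixed_mats_contragredient[OF \<sigma> \<rho> X(1)]
      obtain Y where Y: "Y \<in> carrier_mat n m" "X * Y = 1\<^sub>m m" "Y * X = 1\<^sub>m n"
        using irreducible_intertwiner_invertible[OF irr_\<sigma> irr_\<rho> cX X(2) int] by blast
      have "\<beta> g = \<gamma> g" for g
      proof (cases "g \<in> carrier G")
        case True
        note c = complex_rep_carrier[OF \<sigma> True] complex_rep_carrier[OF \<rho> True]
        have "mtrace (\<sigma> g) = mtrace (\<sigma> g * (X * Y))" using c Y by simp
        also have "\<sigma> g * (X * Y) = X * (\<rho> g * Y)"
          using assoc_mult_mat[OF c(1) cX Y(1)] assoc_mult_mat[OF cX c(2) Y(1)] int[OF True] by simp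
        also have "mtrace \<dots> = mtrace (\<rho> g * Y * X)"
          using c Y by (intro mtrace_mult_commute[OF cX]) auto
        also have "\<rho> g * Y * X = \<rho> g"
          using assoc_mult_mat[OF c(2) Y(1) cX] Y c by simp
        finally show ?thesis
          unfolding \<beta> \<gamma> using character_of_eq_mtrace[OF \<sigma> True] character_of_eq_mtrace[OF \<rho> True] by simp
      \<comment> \<open>Off the carrier both characters are 0 by convention, so they agree as
        functions.\<close>
      qed (simp add: \<beta> \<gamma> character_of_def)
      then show False using \<open>\<beta> \<noteq> \<gamma>\<close> by blast
    qed
  qed
qed

text \<open>\<open>irr_constituents\<close> collects over all decompositions. By orthogonality each
  has the same support, the irreducible characters with nonzero pairing with
  \<open>\<theta>\<close>, so a single one shows all constituents.\<close>

lemma irr_constituents_eq: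
  assumes fin: "finite (carrier G)" and A: "finite A" "A \<subseteq> Irr G" and m: "\<And>\<beta>. \<beta> \<in> A \<Longrightarrow> m \<beta> > (0::nat)"
    and \<theta>: "\<And>g. g \<in> carrier G \<Longrightarrow> \<theta> g = (\<Sum>\<beta>\<in>A. of_nat (m \<beta>) * \<beta> g)"
  shows "irr_constituents G \<theta> = A"
proof -
  have char: "\<gamma> \<in> B \<longleftrightarrow> pairing \<theta> \<gamma> \<noteq> 0"
    if B: "finite B" "B \<subseteq> Irr G" "\<forall>\<beta>\<in>B. k \<beta> > (0::nat)"
      and th: "\<forall>g\<in>carrier G. \<theta> g = (\<Sum>\<beta>\<in>B. of_nat (k \<beta>) * \<beta> g)" and \<gamma>: "\<gamma> \<in> Irr G" for B k \<gamma>
  proof -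
    have "pairing \<theta> \<gamma> = (\<Sum>\<beta>\<in>B. of_nat (k \<beta>) * pairing \<beta> \<gamma>)"
      unfolding pairing_def mean_def using th
      by (simp add: sum_distrib_right sum_distrib_left sum_divide_distrib mult.assoc) (rule sum.swap)
    also have "\<dots> = (\<Sum>\<beta>\<in>B. if \<beta> = \<gamma> then of_nat (k \<gamma>) * pairing \<gamma> \<gamma> else 0)"
      using pairing_irreducible_eq_0_iff[OF fin _ \<gamma>] B by (intro sum.cong) auto
    also have "\<dots> = (if \<gamma> \<in> B then of_nat (k \<gamma>) * pairing \<gamma> \<gamma> else 0)"
      using B(1) by simp
    finally show ?thesis
      using pairing_irreducible_eq_0_iff[OF fin \<gamma> \<gamma>] B(3) by auto
  qed
  have "\<gamma> \<in> irr_constituents G \<theta> \<longleftrightarrow> \<gamma> \<in> A" for \<gamma>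
  proof
    assume "\<gamma> \<in> irr_constituents G \<theta>"
    then obtain B k where B: "finite B" "B \<subseteq> Irr G" "\<gamma> \<in> B" "\<forall>\<beta>\<in>B. k \<beta> > (0::nat)"
      and th: "\<forall>g\<in>carrier G. \<theta> g = (\<Sum>\<beta>\<in>B. of_nat (k \<beta>) * \<beta> g)"
      by (auto simp: irr_constituents_def)
    then have "\<gamma> \<in> Irr G" by blast
    then show "\<gamma> \<in> A" using char[of A m \<gamma>] char[of B k \<gamma>] A B m \<theta> th by blast
  next
    assume "\<gamma> \<in> A"
    then show "\<gamma> \<in> irr_constituents G \<theta>"
      unfolding irr_constituents_def using A m \<theta> by blast
  qed
  then show ?thesis by blast
qed

end

section \<open>Kernels of characters and the derived length of a quotient\<close>

context group
begin

text \<open>At \<open>g\<close> the real part of each constituent is at most its degree. The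
  multiplicities are positive, so equality of the weighted sums forces equality for every
  constituent.\<close>

lemma char_ker_of_sum:
  assumes fin: "finite (carrier G)" and A: "finite A" "A \<subseteq> Irr G" and m: "\<And>\<beta>. \<beta> \<in> A \<Longrightarrow> m \<beta> > (0::nat)"
    and \<theta>: "\<And>g. g \<in> carrier G \<Longrightarrow> \<theta> g = (\<Sum>\<beta>\<in>A. of_nat (m \<beta>) * \<beta> g)"
  shows "char_ker G \<theta> = {g \<in> carrier G. \<forall>\<beta>\<in>A. g \<in> char_ker G \<beta>}"
proof -
  have "g \<in> char_ker G \<beta>" if g: "g \<in> carrier G" and eq: "\<theta> g = \<theta> \<one>" and \<beta>: "\<beta> \<in> A" for g \<beta>
  proof -
    have bound: "cmod (\<gamma> g) \<le> Re (\<gamma> \<one>)" "Im (\<gamma> \<one>) = 0" if \<gamma>: "\<gamma> \<in> A" for \<gamma>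
    proof -
      obtain n \<rho> where "complex_rep G n \<rho>" "\<gamma> = character_of G n \<rho>"
        by (rule Irr_cases[OF subsetD[OF A(2) \<gamma>]])
      then show "cmod (\<gamma> g) \<le> Re (\<gamma> \<one>)" "Im (\<gamma> \<one>) = 0"
        using norm_character_of_le[OF _ g fin] character_of_one by auto
    qed
    have "(\<Sum>\<gamma>\<in>A. of_nat (m \<gamma>) * (\<gamma> \<one> - \<gamma> g)) = 0"
      using eq \<theta>[OF g] \<theta>[OF one_closed] by (simp add: algebra_simps sum_subtractf)
    then have "(\<Sum>\<gamma>\<in>A. of_nat (m \<gamma>) * (Re (\<gamma> \<one>) - Re (\<gamma> g))) = 0"
      by (simp add: Re_sum[symmetric] complex_eq_iff)
    moreover have nonneg: "Re (\<gamma> \<one>) - Re (\<gamma> g) \<ge> 0" if "\<gamma> \<in> A" for \<gamma>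
      using bound[OF that] complex_Re_le_cmod[of "\<gamma> g"] by simp
    ultimately have "of_nat (m \<beta>) * (Re (\<beta> \<one>) - Re (\<beta> g)) = 0"
      using A(1) \<beta> by (subst (asm) sum_nonneg_eq_0_iff) auto
    then have re: "Re (\<beta> g) = Re (\<beta> \<one>)" using m[OF \<beta>] by simp
    \<comment> \<open>The modulus is at most the real part, so the value is real.\<close>
    then have "Im (\<beta> g) = 0"
      using power_mono[OF bound(1)[OF \<beta>] norm_ge_zero, of 2] by (simp add: cmod_power2)
    then show ?thesis using re bound(2)[OF \<beta>] g by (simp add: char_ker_def complex_eq_iff)
  qed
  moreover have "\<theta> g = \<theta> \<one>" if g: "g \<in> carrier G" and k: "\<forall>\<beta>\<in>A. g \<in> char_ker G \<beta>" for g
  proof -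
    have "\<beta> g = \<beta> \<one>" if "\<beta> \<in> A" for \<beta>
      using bspec[OF k that] unfolding char_ker_def by blast
    then show ?thesis
      unfolding \<theta>[OF g] \<theta>[OF one_closed] by (intro sum.cong refl arg_cong2[where f = "(*)"])
  qed
  ultimately show ?thesis unfolding char_ker_def[of G \<theta>] by blast
qed

lemma char_ker_Irr_normal:
  assumes "finite (carrier G)" "\<beta> \<in> Irr G"
  shows "char_ker G \<beta> \<lhd> G"
  using assms char_ker_character_of[OF _ assms(1)] group_hom.normal_kernel[OF complex_rep_group_hom]
  by (auto simp: Irr_def irreducible_rep_def)

lemma Inter_char_ker_normal:
  assumes fin: "finite (carrier G)" and "finite S" "S \<subseteq> Irr G"
  shows "{g \<in> carrier G. \<forall>\<beta>\<in>S. g \<in> char_ker G \<beta>} \<lhd> G"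
  using assms(2,3)
proof (induction S)
  case empty
  then show ?case using normal_self by simp
next
  case (insert \<beta> S)
  have "{g \<in> carrier G. \<forall>\<gamma>\<in>insert \<beta> S. g \<in> char_ker G \<gamma>}
      = char_ker G \<beta> \<inter> {g \<in> carrier G. \<forall>\<gamma>\<in>S. g \<in> char_ker G \<gamma>}"
    by auto
  then show ?case
    using normal_subgroup_intersect[OF char_ker_Irr_normal[OF fin, of \<beta>] insert.IH] insert.prems by simp
qed

text \<open>The derived series of \<open>K\<close> maps onto that of the quotient, so
  \<open>t\<close> is among the lengths over which \<open>LEAST\<close> is taken.\<close>

lemma derived_length_quotient_le:
  assumes K: "subgroup K G" and L: "L \<lhd> G" "L \<subseteq> K" and t: "(derived G ^^ t) K \<subseteq> L"
  shows "derived_length (G\<lparr>carrier := K\<rparr> Mod L) \<le> t"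
proof -
  interpret K: subgroup K G by fact
  let ?K = "G\<lparr>carrier := K\<rparr>"
  interpret L: normal L ?K by (rule normal_restrict_supergroup[OF K L])
  let ?Q = "?K Mod L" and ?p = "\<lambda>a. L #>\<^bsub>?K\<^esub> a"
  interpret Q: group ?Q by (rule L.factorgroup_is_group)
  interpret p: group_hom ?K ?Q ?p
    by unfold_locales (rule L.r_coset_hom_Mod)
  have sub: "(derived G ^^ n) K \<subseteq> K" for n
  proof (induction n)
    case (Suc n)
    then show ?case using derived_incl[OF _ K] by simp
  qed simp
  have D: "(derived ?K ^^ n) K = (derived G ^^ n) K" for n
  proof (induction n)
    case (Suc n)
    then show ?case using derived_consistent[OF sub K] by simp
  qed simp
  have "(derived ?Q ^^ t) (carrier ?Q) = ?p ` ((derived G ^^ t) K)"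
    using p.exp_of_derived_img[of K t] D by (simp add: carrier_FactGroup)
  also have "\<dots> = {L}"
  proof -
    have "?p a = L" if "a \<in> (derived G ^^ t) K" for a
      using that t L.rcos_const by blast
    moreover have "(derived G ^^ t) K \<noteq> {}"
      using subgroup.one_closed[OF exp_of_derived_is_subgroup[OF K]] by blast
    ultimately show ?thesis by auto
  qed
  finally show ?thesis
    unfolding derived_length_def by (intro Least_le) simp
qed

end

section \<open>Counting derived steps over the constituents\<close>

theorem theorem2p8:
  fixes G :: "('a, 'b) monoid_scheme"
    and \<chi> \<psi> \<alpha> :: "'a \<Rightarrow> complex"
  assumes "group G"
    and "finite (carrier G)"
    and "supersolvable G"
    and "\<chi> \<in> Irr G"
    and "\<psi> \<in> Irr G"
    and "\<alpha> \<in> Irr G"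
    and "\<alpha> \<in> irr_constituents G (char_prod \<chi> \<psi>)"
  shows "int (derived_length (G\<lparr>carrier := char_ker G \<alpha>\<rparr> Mod char_ker G (char_prod \<chi> \<psi>)))
           \<le> 2 * int (eta G (char_prod \<chi> \<psi>)) - 1"
proof -
  interpret group G by fact
  note fin = assms(2)
  let ?\<theta> = "char_prod \<chi> \<psi>"
  obtain m \<sigma> where irr_\<sigma>: "irreducible_rep G m \<sigma>" and \<sigma>: "complex_rep G m \<sigma>"
    and \<chi>: "\<chi> = character_of G m \<sigma>"
    using Irr_cases[OF assms(4)] .
  obtain n \<rho> where irr_\<rho>: "irreducible_rep G n \<rho>" and \<rho>: "complex_rep G n \<rho>"
    and \<psi>: "\<psi> = character_of G n \<rho>"
    using Irr_cases[OF assms(5)] .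
  obtain A and k :: "('a \<Rightarrow> complex) \<Rightarrow> nat" where A: "finite A" "A \<subseteq> Irr G" and \<alpha>: "\<alpha> \<in> A"
    and k: "\<And>\<beta>. \<beta> \<in> A \<Longrightarrow> k \<beta> > 0"
    and \<theta>: "\<And>g. g \<in> carrier G \<Longrightarrow> ?\<theta> g = (\<Sum>\<beta>\<in>A. of_nat (k \<beta>) * \<beta> g)"
    using assms(7) unfolding irr_constituents_def by blast
  have eta: "eta G ?\<theta> = card A"
    unfolding eta_def using irr_constituents_eq[OF fin A k \<theta>] by simp
  define Ker where "Ker S = {g \<in> carrier G. \<forall>\<beta>\<in>S. g \<in> char_ker G \<beta>}" for S
  have ker_\<theta>: "char_ker G ?\<theta> = Ker A"
    unfolding Ker_def by (rule char_ker_of_sum[OF fin A k \<theta>])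
  have Ker_normal: "Ker S \<lhd> G" if "S \<subseteq> A" for S
    unfolding Ker_def using that A by (intro Inter_char_ker_normal[OF fin]) (auto intro: finite_subset)
  \<comment> \<open>The dimension of the space of \<open>D\<close>-fixed points, split by
    constituents. Written as a real number so that its sign can be discussed.\<close>
  have mean_\<theta>: "mean D ?\<theta> = of_real (\<Sum>\<beta>\<in>A. k \<beta> * (if D \<subseteq> char_ker G \<beta> then Re (\<beta> \<one>\<^bsub>G\<^esub>) else 0))"
    if D: "D \<lhd> G" for D
  proof -
    have DG: "D \<subseteq> carrier G" using D by (simp add: normal_imp_subgroup subgroup.subset)
    have "mean D ?\<theta> = (\<Sum>\<beta>\<in>A. of_nat (k \<beta>) * mean D \<beta>)"
      unfolding mean_def using \<theta> DG
      by (simp add: subset_iff sum_distrib_left sum_divide_distrib) (rule sum.swap)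
    also have "\<dots> = (\<Sum>\<beta>\<in>A. of_real (k \<beta> * (if D \<subseteq> char_ker G \<beta> then Re (\<beta> \<one>\<^bsub>G\<^esub>) else 0)))"
    proof (rule sum.cong)
      fix \<beta> assume "\<beta> \<in> A"
      then obtain l \<tau> where "irreducible_rep G l \<tau>" "\<beta> = character_of G l \<tau>"
        using Irr_cases[of \<beta> G] A(2) by blast
      then show "of_nat (k \<beta>) * mean D \<beta> = of_real (k \<beta> * (if D \<subseteq> char_ker G \<beta> then Re (\<beta> \<one>\<^bsub>G\<^esub>) else 0))"
        using mean_irreducible[OF _ fin D] character_of_one by (simp add: irreducible_rep_def)
    qed simp
    finally show ?thesis by simp
  qed
  have Re_one: "Re (\<beta> \<one>\<^bsub>G\<^esub>) > 0" if \<beta>: "\<beta> \<in> A" for \<beta>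
  proof -
    obtain l \<tau> where "complex_rep G l \<tau>" "l > 0" "\<beta> = character_of G l \<tau>"
      by (rule Irr_cases[OF subsetD[OF A(2) \<beta>]])
    then show ?thesis using character_of_one by simp
  qed
  \<comment> \<open>Induction on the number of constituents outside \<open>S\<close>: two derived
    steps for each one added and one step at the end. A nonempty \<open>S\<close> provides nonzero
    fixed points.\<close>
  have chain: "\<exists>t \<le> 2 * (card A - card S) + 1. (derived G ^^ t) (Ker S) \<subseteq> Ker A"
    if "S \<subseteq> A" "S \<noteq> {}" for S
    using that
  proof (induction "card A - card S" arbitrary: S rule: less_induct)
    case less
    have SA: "finite S" "S \<subseteq> A" using less.prems A finite_subset by auto
    let ?N = "Ker S" and ?D = "derived G (derived G (Ker S))"
    have N: "?N \<lhd> G" by (rule Ker_normal[OF SA(2)])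
    have N': "derived G ?N \<lhd> G" by (rule derived_is_normal[OF N])
    have D: "?D \<lhd> G" by (rule derived_is_normal[OF N'])
    have N'N: "derived G ?N \<subseteq> ?N" by (rule derived_incl[OF order_refl normal_imp_subgroup[OF N]])
    have DN: "?D \<subseteq> ?N" using derived_incl[OF order_refl normal_imp_subgroup[OF N']] N'N by blast
    consider "S = A" | \<beta> where "\<beta> \<in> A" "?D \<subseteq> char_ker G \<beta>" "\<not> ?N \<subseteq> char_ker G \<beta>"
      | "\<And>\<beta>. \<beta> \<in> A \<Longrightarrow> ?D \<subseteq> char_ker G \<beta> \<longleftrightarrow> ?N \<subseteq> char_ker G \<beta>"
      using DN by blast
    then show ?case
    proof cases
      case 1
      then show ?thesis by (intro exI[of _ 0]) simp
    next
      case 2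
      have "\<beta> \<notin> S" using 2(3) by (auto simp: Ker_def)
      then have cS: "card (insert \<beta> S) = Suc (card S)" using SA by simp
      have "card (insert \<beta> S) \<le> card A" using 2(1) SA A by (intro card_mono) auto
      then have lt: "card A - card (insert \<beta> S) < card A - card S"
        and le: "2 * (card A - card (insert \<beta> S)) + 1 + 2 \<le> 2 * (card A - card S) + 1"
        using cS by auto
      obtain t where t: "t \<le> 2 * (card A - card (insert \<beta> S)) + 1"
        "(derived G ^^ t) (Ker (insert \<beta> S)) \<subseteq> Ker A"
        using less.hyps[OF lt] 2(1) SA by auto
      have "?D \<subseteq> Ker (insert \<beta> S)" using DN 2(2) by (auto simp: Ker_def)
      then have "(derived G ^^ t) ?D \<subseteq> Ker A"
        using mono_exp_of_derived t(2) by blast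
      \<comment> \<open>The two extra steps lead from \<open>?N\<close> down to
        \<open>?D\<close>.\<close>
      then have "(derived G ^^ (t + 2)) ?N \<subseteq> Ker A"
        unfolding funpow_add by (simp add: numeral_2_eq_2)
      then show ?thesis using t(1) le by (intro exI[of _ "t + 2"]) linarith
    next
      case 3
      have eq: "mean ?D ?\<theta> = mean ?N ?\<theta>"
        unfolding mean_\<theta>[OF D] mean_\<theta>[OF N] using 3 by simp
      obtain \<beta> where \<beta>: "\<beta> \<in> S" using less.prems by blast
      \<comment> \<open>\<open>?N\<close> lies in the kernel of every member of \<open>S\<close>, so
        such a member contributes its multiplicity times its degree.\<close>
      have "(\<Sum>\<beta>\<in>A. k \<beta> * (if ?N \<subseteq> char_ker G \<beta> then Re (\<beta> \<one>\<^bsub>G\<^esub>) else 0)) > 0"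
      proof (rule sum_pos2[OF A(1)])
        show "\<beta> \<in> A" using \<beta> SA by blast
        then show "0 < k \<beta> * (if ?N \<subseteq> char_ker G \<beta> then Re (\<beta> \<one>\<^bsub>G\<^esub>) else 0)"
          using \<beta> k Re_one by (auto simp: Ker_def)
      qed (auto intro!: mult_nonneg_nonneg less_imp_le[OF Re_one])
      then have ne: "mean ?N ?\<theta> \<noteq> 0" unfolding mean_\<theta>[OF N] of_real_eq_0_iff by simp
      have "derived G ?N \<subseteq> Ker A"
      proof
        fix x assume x: "x \<in> derived G ?N"
        \<comment> \<open>\<open>x\<close> has to act trivially on both tensor factors; writing the
          product in both orders lets one lemma serve for \<open>\<sigma>\<close> and for
          \<open>\<rho>\<close>.\<close>
        have \<theta>1: "?\<theta> = (\<lambda>g. character_of G m \<sigma> g * character_of G n \<rho> g)"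
          and \<theta>2: "?\<theta> = (\<lambda>g. character_of G n \<rho> g * character_of G m \<sigma> g)"
          by (auto simp: char_prod_def \<chi> \<psi>)
        have xG: "x \<in> carrier G" using x N' normal_imp_subgroup subgroup.mem_carrier by metis
        have "\<sigma> x = 1\<^sub>m m"
          by (rule derived_trivial_if_mean_eq[OF assms(3) fin N irr_\<sigma> \<rho> _ _ x])
            (use eq ne in \<open>simp_all add: \<theta>1\<close>)
        moreover have "\<rho> x = 1\<^sub>m n"
          by (rule derived_trivial_if_mean_eq[OF assms(3) fin N irr_\<rho> \<sigma> _ _ x])
            (use eq ne in \<open>simp_all add: \<theta>2\<close>)
        ultimately have "?\<theta> x = ?\<theta> \<one>\<^bsub>G\<^esub>"
          using xG complex_rep_one[OF \<sigma>] complex_rep_one[OF \<rho>]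
          by (simp add: char_prod_def \<chi> \<psi> character_of_def)
        then show "x \<in> Ker A" using xG by (simp add: char_ker_def flip: ker_\<theta>)
      qed
      then show ?thesis by (intro exI[of _ 1]) simp
    qed
  qed
  have Ker_\<alpha>: "Ker {\<alpha>} = char_ker G \<alpha>" by (auto simp: Ker_def char_ker_def)
  obtain t where t: "t \<le> 2 * (card A - 1) + 1" "(derived G ^^ t) (char_ker G \<alpha>) \<subseteq> Ker A"
    using chain[of "{\<alpha>}"] \<alpha> Ker_\<alpha> by auto
  have "derived_length (G\<lparr>carrier := char_ker G \<alpha>\<rparr> Mod char_ker G ?\<theta>) \<le> t"
    unfolding ker_\<theta>
    using t(2) Ker_normal[of "{\<alpha>}"] Ker_normal[of A] \<alpha> Ker_\<alpha>
    by (intro derived_length_quotient_le) (auto simp: normal_imp_subgroup Ker_def)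
  \<comment> \<open>With \<open>card A\<close> positive the truncated
    \<open>2 * (card A - 1) + 1\<close> is the integer \<open>2 * card A - 1\<close>.\<close>
  moreover have "card A > 0" using \<alpha> A card_gt_0_iff by blast
  ultimately show ?thesis using t(1) eta by linarith
qed

end
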